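(* The theory of Skolem arithmetic $(\mathbb{N},\cdot)$ has ATP. Consequently, any theory interpreting Skolem arithmetic, such as $\mathrm{Th}(\mathbb{Z},+,\cdot,0,1)$ and $\mathrm{ZFC}$ (every completion of it), also has ATP.
   Context: For a complete theory $T$ with monster model $\mathbb{M}$, a formula $\varphi(x,y)$ has the antichain tree property (ATP) if there is a family $(a_\eta)_{\eta\in 2^{<\omega}}$ of parameters in $\mathbb{M}$ such that (i) for every antichain $X\subseteq 2^{<\omega}$ (set of elements pairwise incomparable for the initial segment order $\trianglelefteq$) the set $\{\varphi(x,a_\eta):\eta\in X\}$ is consistent, and (ii) $\{\varphi(x,a_\eta),\varphi(x,a_\nu)\}$ is inconsistent whenever $\eta\trianglelefteq\nu$ and $\eta\neq\nu$. $T$ has ATP if some formula has ATP in $T$. *)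

theory Defs
  imports Main "HOL-Library.Sublist"
begin

unbundle cardinal_syntax

section \<open>First-order logic\<close>

text \<open>A symbol belongs to the language iff it has an arity; this allows languages without function
  symbols or without relation symbols although HOL types are non-empty.\<close>

record ('f, 'r) lang =
  fun_ar :: "'f \<Rightarrow> nat option"
  rel_ar :: "'r \<Rightarrow> nat option"

datatype 'f tm = Var nat | App 'f "'f tm list"

datatype ('f, 'r) fm =
    Eq "'f tm" "'f tm"
  | Atom 'r "'f tm list"
  | Neg "('f, 'r) fm"
  | And "('f, 'r) fm" "('f, 'r) fm"
  | Exists nat "('f, 'r) fm"

abbreviation Or :: "('f, 'r) fm \<Rightarrow> ('f, 'r) fm \<Rightarrow> ('f, 'r) fm" where
  "Or \<phi> \<psi> \<equiv> Neg (And (Neg \<phi>) (Neg \<psi>))"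

abbreviation Imp :: "('f, 'r) fm \<Rightarrow> ('f, 'r) fm \<Rightarrow> ('f, 'r) fm" where
  "Imp \<phi> \<psi> \<equiv> Neg (And \<phi> (Neg \<psi>))"

abbreviation Iff :: "('f, 'r) fm \<Rightarrow> ('f, 'r) fm \<Rightarrow> ('f, 'r) fm" where
  "Iff \<phi> \<psi> \<equiv> And (Imp \<phi> \<psi>) (Imp \<psi> \<phi>)"

abbreviation Forall :: "nat \<Rightarrow> ('f, 'r) fm \<Rightarrow> ('f, 'r) fm" where
  "Forall x \<phi> \<equiv> Neg (Exists x (Neg \<phi>))"

fun wf_tm :: "('f, 'r) lang \<Rightarrow> 'f tm \<Rightarrow> bool" where
  "wf_tm L (Var x) \<longleftrightarrow> True"
| "wf_tm L (App f ts) \<longleftrightarrow> fun_ar L f = Some (length ts) \<and> (\<forall>t \<in> set ts. wf_tm L t)"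

fun wf_fm :: "('f, 'r) lang \<Rightarrow> ('f, 'r) fm \<Rightarrow> bool" where
  "wf_fm L (Eq s t) \<longleftrightarrow> wf_tm L s \<and> wf_tm L t"
| "wf_fm L (Atom r ts) \<longleftrightarrow> rel_ar L r = Some (length ts) \<and> (\<forall>t \<in> set ts. wf_tm L t)"
| "wf_fm L (Neg \<phi>) \<longleftrightarrow> wf_fm L \<phi>"
| "wf_fm L (And \<phi> \<psi>) \<longleftrightarrow> wf_fm L \<phi> \<and> wf_fm L \<psi>"
| "wf_fm L (Exists x \<phi>) \<longleftrightarrow> wf_fm L \<phi>"

fun fv_tm :: "'f tm \<Rightarrow> nat set" where
  "fv_tm (Var x) = {x}"
| "fv_tm (App f ts) = (\<Union>t \<in> set ts. fv_tm t)"

fun fv :: "('f, 'r) fm \<Rightarrow> nat set" where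
  "fv (Eq s t) = fv_tm s \<union> fv_tm t"
| "fv (Atom r ts) = (\<Union>t \<in> set ts. fv_tm t)"
| "fv (Neg \<phi>) = fv \<phi>"
| "fv (And \<phi> \<psi>) = fv \<phi> \<union> fv \<psi>"
| "fv (Exists x \<phi>) = fv \<phi> - {x}"

definition formulas :: "('f, 'r) lang \<Rightarrow> nat \<Rightarrow> ('f, 'r) fm set" where
  "formulas L n = {\<phi>. wf_fm L \<phi> \<and> fv \<phi> \<subseteq> {..<n}}"

abbreviation sentences :: "('f, 'r) lang \<Rightarrow> ('f, 'r) fm set" where
  "sentences L \<equiv> formulas L 0"

record ('f, 'r, 'm) struct =
  univ :: "'m set"
  fun_int :: "'f \<Rightarrow> 'm list \<Rightarrow> 'm"
  rel_int :: "'r \<Rightarrow> 'm list \<Rightarrow> bool"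

definition tuples :: "('f, 'r, 'm) struct \<Rightarrow> nat \<Rightarrow> 'm list set" where
  "tuples M n = {a. length a = n \<and> set a \<subseteq> univ M}"

definition structure_of :: "('f, 'r) lang \<Rightarrow> ('f, 'r, 'm) struct \<Rightarrow> bool" where
  "structure_of L M \<longleftrightarrow> univ M \<noteq> {} \<and>
     (\<forall>f k. fun_ar L f = Some k \<longrightarrow> (\<forall>a \<in> tuples M k. fun_int M f a \<in> univ M))"

fun eval_tm :: "('f, 'r, 'm) struct \<Rightarrow> (nat \<Rightarrow> 'm) \<Rightarrow> 'f tm \<Rightarrow> 'm" where
  "eval_tm M e (Var x) = e x"
| "eval_tm M e (App f ts) = fun_int M f (map (eval_tm M e) ts)"

fun sat :: "('f, 'r, 'm) struct \<Rightarrow> (nat \<Rightarrow> 'm) \<Rightarrow> ('f, 'r) fm \<Rightarrow> bool" where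
  "sat M e (Eq s t) \<longleftrightarrow> eval_tm M e s = eval_tm M e t"
| "sat M e (Atom r ts) \<longleftrightarrow> rel_int M r (map (eval_tm M e) ts)"
| "sat M e (Neg \<phi>) \<longleftrightarrow> \<not> sat M e \<phi>"
| "sat M e (And \<phi> \<psi>) \<longleftrightarrow> sat M e \<phi> \<and> sat M e \<psi>"
| "sat M e (Exists x \<phi>) \<longleftrightarrow> (\<exists>a \<in> univ M. sat M (e(x := a)) \<phi>)"

text \<open>\<open>holds M \<phi> a\<close> is \<open>M \<Turnstile> \<phi>(a)\<close>: the variables \<open>0, 1, \<dots>\<close> take the entries of the tuple \<open>a\<close>. It is
  only used when all free variables of \<open>\<phi>\<close> are below \<open>length a\<close>.\<close>

definition holds :: "('f, 'r, 'm) struct \<Rightarrow> ('f, 'r) fm \<Rightarrow> 'm list \<Rightarrow> bool" where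
  "holds M \<phi> a = sat M (\<lambda>i. if i < length a then a ! i else undefined) \<phi>"

definition model_of :: "('f, 'r) lang \<Rightarrow> ('f, 'r) fm set \<Rightarrow> ('f, 'r, 'm) struct \<Rightarrow> bool" where
  "model_of L T M \<longleftrightarrow> structure_of L M \<and> (\<forall>\<sigma> \<in> T. holds M \<sigma> [])"

definition Th :: "('f, 'r) lang \<Rightarrow> ('f, 'r, 'm) struct \<Rightarrow> ('f, 'r) fm set" where
  "Th L M = {\<sigma> \<in> sentences L. holds M \<sigma> []}"

text \<open>Definitions cannot quantify over the type of the universe of a model. By the
  Loewenheim-Skolem theorem every satisfiable set of \<open>L\<close>-sentences has a model of
  cardinality at most \<open>|L| + \<aleph>\<^sub>0\<close>, hence one whose universe is a set of objects of type
  \<open>('f, 'r) fm\<close>. So it makes no difference if "some model" and "every model" (here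
  and in the definition of interpretability below) refer to models with such universes.

  A complete theory is a satisfiable set of sentences deciding every sentence; complete
  theories are taken to be deductively closed.\<close>

type_synonym ('f, 'r) std_struct = "('f, 'r, ('f, 'r) fm) struct"

definition complete_theory :: "('f, 'r) lang \<Rightarrow> ('f, 'r) fm set \<Rightarrow> bool" where
  "complete_theory L T \<longleftrightarrow> T \<subseteq> sentences L \<and>
     (\<exists>M :: ('f, 'r) std_struct. model_of L T M) \<and>
     (\<forall>\<sigma> \<in> sentences L. \<sigma> \<in> T \<or> Neg \<sigma> \<in> T)"

definition completion :: "('f, 'r) lang \<Rightarrow> ('f, 'r) fm set \<Rightarrow> ('f, 'r) fm set \<Rightarrow> bool" where
  "completion L T T' \<longleftrightarrow> complete_theory L T' \<and> T \<subseteq> T'"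

section \<open>Monster models\<close>

text \<open>A pair \<open>(\<psi>, b)\<close> stands for the formula \<open>\<psi>(x, b)\<close> with parameters \<open>b\<close>, where \<open>x\<close> is a tuple
  of \<open>n\<close> variables: the variables \<open>0, \<dots>, n - 1\<close> are \<open>x\<close> and the following ones are replaced by \<open>b\<close>.
  A set of such formulas is consistent (with the elementary diagram of \<open>M\<close>) iff it is finitely
  satisfiable in \<open>M\<close>.\<close>

definition realizes ::
  "('f, 'r, 'm) struct \<Rightarrow> 'm list \<Rightarrow> (('f, 'r) fm \<times> 'm list) set \<Rightarrow> bool" where
  "realizes M c \<Sigma> \<longleftrightarrow> (\<forall>(\<psi>, b) \<in> \<Sigma>. holds M \<psi> (c @ b))"

definition consistent ::
  "('f, 'r, 'm) struct \<Rightarrow> nat \<Rightarrow> (('f, 'r) fm \<times> 'm list) set \<Rightarrow> bool" where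
  "consistent M n \<Sigma> \<longleftrightarrow>
     (\<forall>\<Sigma>\<^sub>0 \<subseteq> \<Sigma>. finite \<Sigma>\<^sub>0 \<longrightarrow> (\<exists>c \<in> tuples M n. realizes M c \<Sigma>\<^sub>0))"

definition formulas_over ::
  "('f, 'r) lang \<Rightarrow> nat \<Rightarrow> 'm set \<Rightarrow> (('f, 'r) fm \<times> 'm list) set" where
  "formulas_over L n A = {(\<psi>, b). \<psi> \<in> formulas L (n + length b) \<and> set b \<subseteq> A}"

text \<open>Small means of cardinality less than \<open>\<kappa>\<close>, where a monster model is \<open>\<kappa>\<close>-saturated and
  strongly \<open>\<kappa>\<close>-homogeneous for a sufficiently large \<open>\<kappa> > |L| + \<aleph>\<^sub>0\<close>. We take the
  least such cardinal \<open>\<kappa> = (|L| + \<aleph>\<^sub>0)\<^sup>+\<close>, so that monster models for any larger \<open>\<kappa>\<close> are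
  also monster models here. The set of all \<open>L\<close>-formulas has cardinality \<open>|L| + \<aleph>\<^sub>0\<close>.\<close>

definition small :: "('f, 'r) lang \<Rightarrow> 'm set \<Rightarrow> bool" where
  "small L A \<longleftrightarrow> |A| \<le>o |{\<phi>. wf_fm L \<phi>}|"

definition saturated :: "('f, 'r) lang \<Rightarrow> ('f, 'r, 'm) struct \<Rightarrow> bool" where
  "saturated L M \<longleftrightarrow>
     (\<forall>A \<Sigma>. A \<subseteq> univ M \<and> small L A \<and> \<Sigma> \<subseteq> formulas_over L 1 A \<and> consistent M 1 \<Sigma>
        \<longrightarrow> (\<exists>c \<in> tuples M 1. realizes M c \<Sigma>))"

definition automorphism :: "('f, 'r) lang \<Rightarrow> ('f, 'r, 'm) struct \<Rightarrow> ('m \<Rightarrow> 'm) \<Rightarrow> bool" where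
  "automorphism L M g \<longleftrightarrow> bij_betw g (univ M) (univ M) \<and>
     (\<forall>f k. fun_ar L f = Some k \<longrightarrow>
        (\<forall>a \<in> tuples M k. g (fun_int M f a) = fun_int M f (map g a))) \<and>
     (\<forall>r k. rel_ar L r = Some k \<longrightarrow>
        (\<forall>a \<in> tuples M k. rel_int M r (map g a) \<longleftrightarrow> rel_int M r a))"

definition partial_elementary ::
  "('f, 'r) lang \<Rightarrow> ('f, 'r, 'm) struct \<Rightarrow> 'm set \<Rightarrow> ('m \<Rightarrow> 'm) \<Rightarrow> bool" where
  "partial_elementary L M A h \<longleftrightarrow> A \<subseteq> univ M \<and> h ` A \<subseteq> univ M \<and>
     (\<forall>a \<psi>. set a \<subseteq> A \<and> \<psi> \<in> formulas L (length a) \<longrightarrow> (holds M \<psi> (map h a) \<longleftrightarrow> holds M \<psi> a))"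

definition strongly_homogeneous :: "('f, 'r) lang \<Rightarrow> ('f, 'r, 'm) struct \<Rightarrow> bool" where
  "strongly_homogeneous L M \<longleftrightarrow>
     (\<forall>A h. small L A \<and> partial_elementary L M A h
        \<longrightarrow> (\<exists>g. automorphism L M g \<and> (\<forall>a \<in> A. g a = h a)))"

definition monster_model ::
  "('f, 'r) lang \<Rightarrow> ('f, 'r) fm set \<Rightarrow> ('f, 'r, 'm) struct \<Rightarrow> bool" where
  "monster_model L T M \<longleftrightarrow> model_of L T M \<and> saturated L M \<and> strongly_homogeneous L M"

section \<open>The antichain tree property\<close>

text \<open>The tree \<open>2\<^bsup><\<omega>\<^esup>\<close> is the type \<open>bool list\<close>. In \<open>\<phi>(x, y)\<close> the tuple \<open>x\<close> consists
  of the variables below \<open>n\<close>, the tuple \<open>y\<close> of the following \<open>m\<close> variables.\<close>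

definition ATP_formula ::
  "('f, 'r) lang \<Rightarrow> ('f, 'r, 'm) struct \<Rightarrow> nat \<Rightarrow> nat \<Rightarrow> ('f, 'r) fm \<Rightarrow> bool" where
  "ATP_formula L M n m \<phi> \<longleftrightarrow> \<phi> \<in> formulas L (n + m) \<and>
     (\<exists>a :: bool list \<Rightarrow> 'm list.
        (\<forall>\<eta>. a \<eta> \<in> tuples M m) \<and>
        (\<forall>X. pairwise (\<lambda>\<eta> \<nu>. \<eta> \<parallel> \<nu>) X \<longrightarrow> consistent M n {(\<phi>, a \<eta>) |\<eta>. \<eta> \<in> X}) \<and>
        (\<forall>\<eta> \<nu>. prefix \<eta> \<nu> \<and> \<eta> \<noteq> \<nu> \<longrightarrow> \<not> consistent M n {(\<phi>, a \<eta>), (\<phi>, a \<nu>)}))"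

text \<open>A theory has ATP iff its monster models (of any universe type) satisfy this.\<close>

definition has_ATP :: "('f, 'r) lang \<Rightarrow> ('f, 'r, 'm) struct \<Rightarrow> bool" where
  "has_ATP L M \<longleftrightarrow> (\<exists>n m \<phi>. ATP_formula L M n m \<phi>)"

section \<open>Interpretations\<close>

text \<open>Parameter-free interpretations of an \<open>L'\<close>-structure in an \<open>L\<close>-structure, with elements
  represented by tuples of length \<open>i_dim\<close> modulo a definable equivalence relation. Functions are
  given by their graphs (value last).\<close>

record ('f, 'r, 'g, 's) interp =
  i_dim :: nat
  i_dom :: "('f, 'r) fm"
  i_eq :: "('f, 'r) fm"
  i_fun :: "'g \<Rightarrow> ('f, 'r) fm"
  i_rel :: "'s \<Rightarrow> ('f, 'r) fm"

definition interp_formulas ::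
  "('f, 'r) lang \<Rightarrow> ('g, 's) lang \<Rightarrow> ('f, 'r, 'g, 's) interp \<Rightarrow> bool" where
  "interp_formulas L L' \<iota> \<longleftrightarrow> 0 < i_dim \<iota> \<and>
     i_dom \<iota> \<in> formulas L (i_dim \<iota>) \<and>
     i_eq \<iota> \<in> formulas L (2 * i_dim \<iota>) \<and>
     (\<forall>f k. fun_ar L' f = Some k \<longrightarrow> i_fun \<iota> f \<in> formulas L ((k + 1) * i_dim \<iota>)) \<and>
     (\<forall>r k. rel_ar L' r = Some k \<longrightarrow> i_rel \<iota> r \<in> formulas L (k * i_dim \<iota>))"

definition interp_dom ::
  "('f, 'r, 'g, 's) interp \<Rightarrow> ('f, 'r, 'm) struct \<Rightarrow> 'm list set" where
  "interp_dom \<iota> M = {a \<in> tuples M (i_dim \<iota>). holds M (i_dom \<iota>) a}"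

definition interp_eq ::
  "('f, 'r, 'g, 's) interp \<Rightarrow> ('f, 'r, 'm) struct \<Rightarrow> ('m list \<times> 'm list) set" where
  "interp_eq \<iota> M =
     {(a, b). a \<in> interp_dom \<iota> M \<and> b \<in> interp_dom \<iota> M \<and> holds M (i_eq \<iota>) (a @ b)}"

definition interp_well_defined ::
  "('g, 's) lang \<Rightarrow> ('f, 'r, 'g, 's) interp \<Rightarrow> ('f, 'r, 'm) struct \<Rightarrow> bool" where
  "interp_well_defined L' \<iota> M \<longleftrightarrow>
     (let D = interp_dom \<iota> M; R = interp_eq \<iota> M in
      D \<noteq> {} \<and> equiv D R \<and>
      (\<forall>f k as. fun_ar L' f = Some k \<and> length as = k \<and> set as \<subseteq> D \<longrightarrow>
         (\<exists>b \<in> D. holds M (i_fun \<iota> f) (concat as @ b))) \<and>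
      (\<forall>f k as as' b b'. fun_ar L' f = Some k \<and> length as = k \<and>
         list_all2 (\<lambda>x y. (x, y) \<in> R) as as' \<and> b \<in> D \<and> b' \<in> D \<and>
         holds M (i_fun \<iota> f) (concat as @ b) \<longrightarrow>
         (holds M (i_fun \<iota> f) (concat as' @ b') \<longleftrightarrow> (b, b') \<in> R)) \<and>
      (\<forall>r k as as'. rel_ar L' r = Some k \<and> length as = k \<and>
         list_all2 (\<lambda>x y. (x, y) \<in> R) as as' \<longrightarrow>
         (holds M (i_rel \<iota> r) (concat as) \<longleftrightarrow> holds M (i_rel \<iota> r) (concat as'))))"

definition interp_struct ::
  "('f, 'r, 'g, 's) interp \<Rightarrow> ('f, 'r, 'm) struct \<Rightarrow> ('g, 's, 'm list set) struct" where
  "interp_struct \<iota> M =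
     \<lparr> univ = interp_dom \<iota> M // interp_eq \<iota> M,
       fun_int = (\<lambda>f Cs. THE C. C \<in> interp_dom \<iota> M // interp_eq \<iota> M \<and>
         (\<exists>as b. list_all2 (\<in>) as Cs \<and> b \<in> C \<and> holds M (i_fun \<iota> f) (concat as @ b))),
       rel_int = (\<lambda>r Cs. \<exists>as. list_all2 (\<in>) as Cs \<and> holds M (i_rel \<iota> r) (concat as)) \<rparr>"

definition interprets ::
  "('f, 'r) lang \<Rightarrow> ('f, 'r) fm set \<Rightarrow> ('g, 's) lang \<Rightarrow> ('g, 's) fm set \<Rightarrow> bool" where
  "interprets L T L' T' \<longleftrightarrow>
     (\<exists>\<iota>. interp_formulas L L' \<iota> \<and>
        (\<forall>M :: ('f, 'r) std_struct. model_of L T M \<longrightarrow>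
           interp_well_defined L' \<iota> M \<and> model_of L' T' (interp_struct \<iota> M)))"

section \<open>Skolem arithmetic, the ring of integers, ZFC\<close>

definition skolem_lang :: "(unit, unit) lang" where
  "skolem_lang = \<lparr> fun_ar = (\<lambda>_. Some 2), rel_ar = (\<lambda>_. None) \<rparr>"

definition skolem_struct :: "(unit, unit, nat) struct" where
  "skolem_struct =
     \<lparr> univ = UNIV, fun_int = (\<lambda>_ xs. xs ! 0 * xs ! 1), rel_int = (\<lambda>_ _. False) \<rparr>"

definition skolem_arithmetic :: "(unit, unit) fm set" where
  "skolem_arithmetic = Th skolem_lang skolem_struct"

datatype ring_sym = Plus | Times | Zero | One

definition ring_lang :: "(ring_sym, unit) lang" where
  "ring_lang =
     \<lparr> fun_ar = (\<lambda>f. case f of Plus \<Rightarrow> Some 2 | Times \<Rightarrow> Some 2 | Zero \<Rightarrow> Some 0 | One \<Rightarrow> Some 0),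
       rel_ar = (\<lambda>_. None) \<rparr>"

definition int_ring :: "(ring_sym, unit, int) struct" where
  "int_ring =
     \<lparr> univ = UNIV,
       fun_int = (\<lambda>f xs. case f of Plus \<Rightarrow> xs ! 0 + xs ! 1 | Times \<Rightarrow> xs ! 0 * xs ! 1
                                 | Zero \<Rightarrow> 0 | One \<Rightarrow> 1),
       rel_int = (\<lambda>_ _. False) \<rparr>"

definition set_lang :: "(unit, unit) lang" where
  "set_lang = \<lparr> fun_ar = (\<lambda>_. None), rel_ar = (\<lambda>_. Some 2) \<rparr>"

type_synonym set_fm = "(unit, unit) fm"

abbreviation Mem :: "nat \<Rightarrow> nat \<Rightarrow> set_fm" where
  "Mem x y \<equiv> Atom () [Var x, Var y]"

abbreviation Equal :: "nat \<Rightarrow> nat \<Rightarrow> set_fm" where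
  "Equal x y \<equiv> Eq (Var x) (Var y)"

abbreviation Forall_in :: "nat \<Rightarrow> nat \<Rightarrow> set_fm \<Rightarrow> set_fm" where
  "Forall_in x a \<phi> \<equiv> Forall x (Imp (Mem x a) \<phi>)"

abbreviation Exists_in :: "nat \<Rightarrow> nat \<Rightarrow> set_fm \<Rightarrow> set_fm" where
  "Exists_in x a \<phi> \<equiv> Exists x (And (Mem x a) \<phi>)"

definition universal_closure :: "('f, 'r) fm \<Rightarrow> ('f, 'r) fm" where
  "universal_closure \<phi> = foldr Forall (sorted_list_of_set (fv \<phi>)) \<phi>"

definition extensionality :: set_fm where
  "extensionality =
     Forall 0 (Forall 1 (Imp (Forall 2 (Iff (Mem 2 0) (Mem 2 1))) (Equal 0 1)))"

definition foundation :: set_fm where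
  "foundation =
     Forall 0 (Imp (Exists 1 (Mem 1 0)) (Exists_in 1 0 (Neg (Exists_in 2 0 (Mem 2 1)))))"

definition pairing :: set_fm where
  "pairing =
     Forall 0 (Forall 1 (Exists 2 (Forall 3 (Iff (Mem 3 2) (Or (Equal 3 0) (Equal 3 1))))))"

definition union :: set_fm where
  "union = Forall 0 (Exists 1 (Forall 2 (Iff (Mem 2 1) (Exists_in 3 0 (Mem 2 3)))))"

definition power_set :: set_fm where
  "power_set = Forall 0 (Exists 1 (Forall 2 (Iff (Mem 2 1) (Forall_in 3 2 (Mem 3 0)))))"

definition infinity :: set_fm where
  "infinity =
     Exists 0 (And
       (Exists_in 1 0 (Forall 2 (Neg (Mem 2 1))))
       (Forall_in 1 0 (Exists_in 2 0 (Forall 3 (Iff (Mem 3 2) (Or (Mem 3 1) (Equal 3 1)))))))"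

text \<open>Choice: every set of non-empty pairwise disjoint sets has a transversal.\<close>

definition choice :: set_fm where
  "choice =
     Forall 0 (Imp
       (And (Forall_in 1 0 (Exists 2 (Mem 2 1)))
            (Forall_in 1 0 (Forall_in 2 0
               (Imp (Neg (Equal 1 2)) (Neg (Exists_in 3 1 (Mem 3 2)))))))
       (Exists 4 (Forall_in 1 0
          (Exists 2 (Forall 3 (Iff (And (Mem 3 1) (Mem 3 4)) (Equal 3 2)))))))"

text \<open>In the schemes, the variables of \<open>\<phi>\<close> other than \<open>0\<close> (and \<open>1\<close>, for replacement) are
  parameters. Separation says \<open>\<forall>a \<exists>b \<forall>x. x \<in> b \<longleftrightarrow> x \<in> a \<and> \<phi>(x)\<close>; replacement says
  \<open>\<forall>a. (\<forall>x\<in>a. \<exists>!y. \<phi>(x,y)) \<longrightarrow> (\<exists>b \<forall>y. y \<in> b \<longleftrightarrow> (\<exists>x\<in>a. \<phi>(x,y)))\<close>. Here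
  \<open>x, y, a, b\<close> are the variables \<open>0, 1, 2, 3\<close>.\<close>

definition separation :: "set_fm \<Rightarrow> set_fm" where
  "separation \<phi> = universal_closure
     (Forall 2 (Exists 3 (Forall 0 (Iff (Mem 0 3) (And (Mem 0 2) \<phi>)))))"

definition replacement :: "set_fm \<Rightarrow> set_fm" where
  "replacement \<phi> = universal_closure
     (Forall 2 (Imp
        (Forall_in 0 2 (Exists 4 (Forall 1 (Iff \<phi> (Equal 1 4)))))
        (Exists 3 (Forall 1 (Iff (Mem 1 3) (Exists_in 0 2 \<phi>))))))"

definition ZFC :: "set_fm set" where
  "ZFC = {extensionality, foundation, pairing, union, power_set, infinity, choice}
     \<union> {separation \<phi> |\<phi>. wf_fm set_lang \<phi> \<and> 3 \<notin> fv \<phi>}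
     \<union> {replacement \<phi> |\<phi>. wf_fm set_lang \<phi> \<and> 3 \<notin> fv \<phi> \<and> 4 \<notin> fv \<phi>}"

end

theory Submission
  imports Defs "HOL-Library.Countable" "HOL-Computational_Algebra.Primes"
begin

text \<open>The formula "\<open>u\<close> divides \<open>x\<close> and \<open>v\<close> does not" has ATP in Skolem arithmetic and in the ring of
  integers. For a finite set of nodes of the tree, choose distinct primes \<open>q \<nu>\<close>, let \<open>u \<eta>\<close> be the
  product of the \<open>q \<nu>\<close> over the strict descendants \<open>\<nu>\<close> of \<open>\<eta>\<close>, and let \<open>v = q\<close>. If \<open>\<nu>\<close> is a
  strict descendant of \<open>\<eta>\<close>, then \<open>v \<nu>\<close> divides \<open>u \<eta>\<close>, so the instances at \<open>\<eta>\<close> and \<open>\<nu>\<close>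
  contradict each other; the instances at an antichain are solved by the product of its \<open>u \<eta>\<close>. In set
  theory "\<open>u \<subseteq> x\<close> and \<open>v \<notin> x\<close>" works in the same way with finite sets instead of products. An
  interpretation turns the divisibility formula into one with the same property. Finite patterns are
  expressed by sentences, so they exist in the monster model, and saturation combines them, choosing
  the entries of the parameters one after the other.\<close>

section \<open>Renaming, conjunctions and quantifier blocks\<close>

lemma eval_tm_cong: "(\<And>i. i \<in> fv_tm t \<Longrightarrow> e i = e' i) \<Longrightarrow> eval_tm M e t = eval_tm M e' t"
proof (induction t)
  case (App f ts)
  have "map (eval_tm M e) ts = map (eval_tm M e') ts"
    using App by (intro map_cong) auto
  then show ?case by (simp only: eval_tm.simps)
qed auto

lemma sat_cong: "(\<And>i. i \<in> fv \<phi> \<Longrightarrow> e i = e' i) \<Longrightarrow> sat M e \<phi> = sat M e' \<phi>"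
proof (induction \<phi> arbitrary: e e')
  case (Eq s t)
  then show ?case using eval_tm_cong[of s e e' M] eval_tm_cong[of t e e' M] by auto
next
  case (Atom r ts)
  have "map (eval_tm M e) ts = map (eval_tm M e') ts"
    using Atom by (intro map_cong eval_tm_cong) auto
  then show ?case by (simp only: sat.simps)
next
  case (And \<phi> \<psi>)
  have "sat M e \<phi> = sat M e' \<phi>" "sat M e \<psi> = sat M e' \<psi>"
    using And.prems by (intro And.IH; simp)+
  then show ?case by simp
next
  case (Exists x \<phi>)
  have "sat M (e(x := a)) \<phi> = sat M (e'(x := a)) \<phi>" for a
    using Exists.prems by (intro Exists.IH) auto
  then show ?case by simp
next
  case (Neg \<phi>)
  have "sat M e \<phi> = sat M e' \<phi>" using Neg.prems by (intro Neg.IH) simp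
  then show ?case by simp
qed

lemma finite_fv_tm: "finite (fv_tm t)"
  by (induction t) auto

lemma finite_fv: "finite (fv \<phi>)"
  by (induction \<phi>) (auto simp: finite_fv_tm)

section \<open>Renaming of variables and instances of formulas\<close>

fun rename_tm :: "(nat \<Rightarrow> nat) \<Rightarrow> 'f tm \<Rightarrow> 'f tm" where
  "rename_tm p (Var x) = Var (p x)"
| "rename_tm p (App f ts) = App f (map (rename_tm p) ts)"

fun rename :: "(nat \<Rightarrow> nat) \<Rightarrow> ('f, 'r) fm \<Rightarrow> ('f, 'r) fm" where
  "rename p (Eq s t) = Eq (rename_tm p s) (rename_tm p t)"
| "rename p (Atom r ts) = Atom r (map (rename_tm p) ts)"
| "rename p (Neg \<phi>) = Neg (rename p \<phi>)"
| "rename p (And \<phi> \<psi>) = And (rename p \<phi>) (rename p \<psi>)"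
| "rename p (Exists x \<phi>) = Exists (p x) (rename p \<phi>)"

lemma eval_rename_tm: "eval_tm M e (rename_tm p t) = eval_tm M (e \<circ> p) t"
proof (induction t)
  case (App f ts)
  have "map (eval_tm M e \<circ> rename_tm p) ts = map (eval_tm M (e \<circ> p)) ts"
    using App by (intro map_cong) (simp_all add: comp_def)
  then show ?case by (simp only: rename_tm.simps eval_tm.simps map_map)
qed simp

lemma eval_map_rename_tm:
  "map (eval_tm M e \<circ> rename_tm p) ts = map (eval_tm M (e \<circ> p)) ts"
  by (rule map_cong) (simp_all add: eval_rename_tm)

text \<open>Bound variables are renamed as well, so injectivity rules out capture.\<close>

lemma sat_rename:
  assumes "inj p"
  shows "sat M e (rename p \<phi>) = sat M (e \<circ> p) \<phi>"
proof (induction \<phi> arbitrary: e)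
  case (Exists x \<phi>)
  have "e(p x := a) \<circ> p = (e \<circ> p)(x := a)" for a
    using assms by (auto simp: fun_eq_iff inj_eq)
  then show ?case by (simp only: rename.simps sat.simps Exists)
qed (simp_all add: eval_rename_tm eval_map_rename_tm)

lemma fv_rename_tm: "fv_tm (rename_tm p t) = p ` fv_tm t"
  by (induction t) auto

lemma fv_rename: "inj p \<Longrightarrow> fv (rename p \<phi>) = p ` fv \<phi>"
  by (induction \<phi>) (auto simp: fv_rename_tm inj_eq)

lemma wf_rename_tm: "wf_tm L (rename_tm p t) = wf_tm L t"
  by (induction t) auto

lemma wf_rename: "wf_fm L (rename p \<phi>) = wf_fm L \<phi>"
  by (induction \<phi>) (auto simp: wf_rename_tm)

text \<open>An instance prescribes only where the free variables go, while capture-free renaming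
  asks for an injection on all variables. Inside the finite set \<open>S\<close> the two complements
  have equally many elements and are matched by \<open>h\<close>; outside \<open>S\<close> the map
  is the identity.\<close>

lemma inj_on_extends_to_bij:
  fixes f :: "nat \<Rightarrow> nat"
  assumes "inj_on f {..<n}"
  shows "\<exists>p. bij p \<and> (\<forall>i<n. p i = f i)"
proof -
  define S where "S = {..<n} \<union> f ` {..<n}"
  have fin: "finite S" by (simp add: S_def)
  have "card (S - {..<n}) = card (S - f ` {..<n})"
    using fin card_image[OF assms] by (simp add: S_def card_Diff_subset)
  then obtain h where h: "bij_betw h (S - {..<n}) (S - f ` {..<n})"
    using finite_same_card_bij[of "S - {..<n}" "S - f ` {..<n}"] fin by auto
  define p where "p i = (if i < n then f i else if i \<in> S then h i else i)" for i
  have 1: "bij_betw p {..<n} (f ` {..<n})"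
    using assms by (simp add: bij_betw_def p_def inj_on_def image_def)
  have 2: "bij_betw p (S - {..<n}) (S - f ` {..<n})"
    using h by (rule bij_betw_cong[THEN iffD1, rotated]) (auto simp: p_def)
  have 3: "bij_betw p (- S) (- S)"
    using bij_betw_id[of "- S"]
    by (rule bij_betw_cong[THEN iffD1, rotated]) (auto simp: p_def S_def)
  have "bij_betw p ({..<n} \<union> (S - {..<n})) (f ` {..<n} \<union> (S - f ` {..<n}))"
    by (rule bij_betw_combine[OF 1 2]) auto
  moreover have "{..<n} \<union> (S - {..<n}) = S" "f ` {..<n} \<union> (S - f ` {..<n}) = S"
    by (auto simp: S_def)
  ultimately have "bij_betw p S S" by simp
  then have "bij_betw p (S \<union> - S) (S \<union> - S)"
    by (rule bij_betw_combine[OF _ 3]) auto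
  then have "bij p" by simp
  then show ?thesis by (intro exI[of _ p]) (auto simp: p_def)
qed

text \<open>The permutation is chosen from \<open>f\<close> and \<open>n\<close> alone. Where it
  sends the variables from \<open>n\<close> on does not affect the meaning of a formula whose free
  variables lie below \<open>n\<close>.\<close>

definition inst :: "(nat \<Rightarrow> nat) \<Rightarrow> nat \<Rightarrow> ('f, 'r) fm \<Rightarrow> ('f, 'r) fm" where
  "inst f n = rename (SOME p. bij p \<and> (\<forall>i<n. p i = f i))"

lemma inst_eq_rename:
  assumes "inj_on f {..<n}"
  obtains p where "bij p" "\<And>i. i < n \<Longrightarrow> p i = f i" "inst f n \<phi> = rename p \<phi>"
  using someI_ex[OF inj_on_extends_to_bij[OF assms]] unfolding inst_def by blast

lemma inst_formula:
  assumes "inj_on f {..<n}" "\<phi> \<in> formulas L n"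
  shows "wf_fm L (inst f n \<phi>)" "fv (inst f n \<phi>) \<subseteq> f ` {..<n}"
proof -
  obtain p where p: "bij p" "\<And>i. i < n \<Longrightarrow> p i = f i" "inst f n \<phi> = rename p \<phi>"
    using inst_eq_rename[OF assms(1)] by blast
  show "wf_fm L (inst f n \<phi>)" using assms(2) by (simp add: p(3) wf_rename formulas_def)
  have "fv \<phi> \<subseteq> {..<n}" using assms(2) by (simp add: formulas_def)
  then show "fv (inst f n \<phi>) \<subseteq> f ` {..<n}"
    using p(1,2) by (auto simp: p(3) fv_rename bij_is_inj)
qed

lemma holds_iff_sat:
  assumes "\<phi> \<in> formulas L (length a)" "\<And>i. i < length a \<Longrightarrow> e i = a ! i"
  shows "holds M \<phi> a \<longleftrightarrow> sat M e \<phi>"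
  unfolding holds_def using assms by (intro sat_cong) (auto simp: formulas_def)

lemma sat_inst:
  assumes "inj_on f {..<n}" "\<phi> \<in> formulas L n"
  shows "sat M e (inst f n \<phi>) \<longleftrightarrow> holds M \<phi> (map (\<lambda>i. e (f i)) [0..<n])"
proof -
  obtain p where p: "bij p" "\<And>i. i < n \<Longrightarrow> p i = f i" "inst f n \<phi> = rename p \<phi>"
    using inst_eq_rename[OF assms(1)] by blast
  have "holds M \<phi> (map (\<lambda>i. e (f i)) [0..<n]) \<longleftrightarrow> sat M (e \<circ> p) \<phi>"
    using assms(2) p(2) by (intro holds_iff_sat[where L = L]) auto
  then show ?thesis by (simp add: p(1,3) sat_rename bij_is_inj)
qed

section \<open>Blocks of existential quantifiers\<close>

abbreviation exs :: "nat list \<Rightarrow> ('f, 'r) fm \<Rightarrow> ('f, 'r) fm" where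
  "exs xs \<phi> \<equiv> foldr Exists xs \<phi>"

lemma fv_exs: "fv (exs xs \<phi>) = fv \<phi> - set xs"
  by (induction xs) auto

lemma wf_exs: "wf_fm L (exs xs \<phi>) = wf_fm L \<phi>"
  by (induction xs) auto

lemma sat_exs:
  "sat M e (exs xs \<phi>) \<longleftrightarrow>
     (\<exists>e'. (\<forall>i. i \<notin> set xs \<longrightarrow> e' i = e i) \<and> (\<forall>i \<in> set xs. e' i \<in> univ M) \<and> sat M e' \<phi>)"
proof (induction xs arbitrary: e)
  case Nil
  have "e' = e" if "\<forall>i. e' i = e i" for e' using that by auto
  then show ?case by (auto intro: exI[of _ e])
next
  case (Cons x xs)
  show ?case
  proof
    assume "sat M e (exs (x # xs) \<phi>)"
    then obtain a e' where a: "a \<in> univ M" and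
      e': "\<forall>i. i \<notin> set xs \<longrightarrow> e' i = (e(x := a)) i" "\<forall>i \<in> set xs. e' i \<in> univ M" "sat M e' \<phi>"
      by (auto simp: Cons.IH)
    \<comment> \<open>A variable may occur twice in the block; then the inner occurrence determines
      its value, otherwise the value is \<open>a\<close>.\<close>
    have "e' x \<in> univ M" using e' a by (cases "x \<in> set xs") auto
    then show "\<exists>e'. (\<forall>i. i \<notin> set (x # xs) \<longrightarrow> e' i = e i) \<and>
        (\<forall>i \<in> set (x # xs). e' i \<in> univ M) \<and> sat M e' \<phi>"
      using e' by (intro exI[of _ e']) auto
  next
    assume "\<exists>e'. (\<forall>i. i \<notin> set (x # xs) \<longrightarrow> e' i = e i) \<and>
        (\<forall>i \<in> set (x # xs). e' i \<in> univ M) \<and> sat M e' \<phi>"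
    then obtain e' where e': "\<forall>i. i \<notin> set (x # xs) \<longrightarrow> e' i = e i"
        "\<forall>i \<in> set (x # xs). e' i \<in> univ M" "sat M e' \<phi>" by blast
    then show "sat M e (exs (x # xs) \<phi>)"
      by (auto simp: Cons.IH intro!: bexI[of _ "e' x"] exI[of _ e'])
  qed
qed

text \<open>\<open>P\<close> sees the values of the block only through the list; in its other
  argument the block is blanked out, so the quantifiers leave that argument unchanged. Hence a block
  of quantifiers becomes one quantifier over tuples.\<close>

lemma sat_exs_upt:
  assumes "\<And>e. sat M e \<phi> \<longleftrightarrow> P (map e [k..<k + n]) (\<lambda>i. if i \<in> {k..<k + n} then undefined else e i)"
  shows "sat M e (exs [k..<k + n] \<phi>) \<longleftrightarrow>
    (\<exists>c \<in> tuples M n. P c (\<lambda>i. if i \<in> {k..<k + n} then undefined else e i))"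
proof -
  let ?r = "\<lambda>e i. if i \<in> {k..<k + n} then undefined else e i"
  have "(\<exists>e'. (\<forall>i. i \<notin> {k..<k + n} \<longrightarrow> e' i = e i) \<and> (\<forall>i \<in> {k..<k + n}. e' i \<in> univ M) \<and>
          P (map e' [k..<k + n]) (?r e')) \<longleftrightarrow> (\<exists>c \<in> tuples M n. P c (?r e))" (is "?A \<longleftrightarrow> ?B")
  proof
    assume ?A
    then obtain e' where e': "\<forall>i. i \<notin> {k..<k + n} \<longrightarrow> e' i = e i"
      "\<forall>i \<in> {k..<k + n}. e' i \<in> univ M" "P (map e' [k..<k + n]) (?r e')" by blast
    have "?r e' = ?r e" using e'(1) by (auto simp: fun_eq_iff)
    with e'(3) have "P (map e' [k..<k + n]) (?r e)" by simp
    moreover have "map e' [k..<k + n] \<in> tuples M n"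
      using e'(2) by (auto simp: tuples_def)
    ultimately show ?B by blast
  next
    assume ?B
    then obtain c where c: "c \<in> tuples M n" "P c (?r e)" by blast
    define e' where "e' i = (if i \<in> {k..<k + n} then c ! (i - k) else e i)" for i
    have "map e' [k..<k + n] = c"
      using c(1) by (intro nth_equalityI) (auto simp: tuples_def e'_def)
    moreover have "?r e' = ?r e" by (auto simp: e'_def)
    moreover have "\<forall>i \<in> {k..<k + n}. e' i \<in> univ M"
      using c(1) by (auto simp: e'_def tuples_def subset_iff)
    ultimately show ?A using c(2) by (intro exI[of _ e']) (auto simp: e'_def)
  qed
  then show ?thesis unfolding sat_exs by (simp add: assms)
qed

section \<open>Finite conjunctions\<close>

text \<open>The fold ends in a sentence true in every nonempty structure, so it contributes no free
  variable, and any enumeration of \<open>S\<close> serves.\<close>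

definition Conj :: "('f, 'r) fm set \<Rightarrow> ('f, 'r) fm" where
  "Conj S = foldr And (SOME l. set l = S) (Exists 0 (Eq (Var 0) (Var 0)))"

lemma Conj_props:
  assumes "finite S"
  shows sat_Conj: "univ M \<noteq> {} \<Longrightarrow> sat M e (Conj S) \<longleftrightarrow> (\<forall>\<phi> \<in> S. sat M e \<phi>)"
    and fv_Conj: "fv (Conj S) = (\<Union>\<phi> \<in> S. fv \<phi>)"
    and wf_Conj: "wf_fm L (Conj S) \<longleftrightarrow> (\<forall>\<phi> \<in> S. wf_fm L \<phi>)"
proof -
  let ?l = "SOME l. set l = S"
  have l: "set ?l = S" using finite_list[OF assms] by (rule someI_ex)
  have "sat M e (foldr And l (Exists 0 (Eq (Var 0) (Var 0)))) \<longleftrightarrow> (\<forall>\<phi> \<in> set l. sat M e \<phi>)"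
    if "univ M \<noteq> {}" for l
    using that by (induction l) auto
  from this[of ?l] show "univ M \<noteq> {} \<Longrightarrow> sat M e (Conj S) \<longleftrightarrow> (\<forall>\<phi> \<in> S. sat M e \<phi>)"
    unfolding l Conj_def .
  have "fv (foldr And l (Exists 0 (Eq (Var 0) (Var 0)))) = (\<Union>\<phi> \<in> set l. fv \<phi>)"
    for l :: "('f, 'r) fm list"
    by (induction l) auto
  from this[of ?l] show "fv (Conj S) = (\<Union>\<phi> \<in> S. fv \<phi>)"
    unfolding l Conj_def .
  have "wf_fm L (foldr And l (Exists 0 (Eq (Var 0) (Var 0)))) \<longleftrightarrow> (\<forall>\<phi> \<in> set l. wf_fm L \<phi>)" for l
    by (induction l) auto
  from this[of ?l] show "wf_fm L (Conj S) \<longleftrightarrow> (\<forall>\<phi> \<in> S. wf_fm L \<phi>)"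
    unfolding l Conj_def .
qed

section \<open>Satisfiability in elementarily equivalent and in saturated structures\<close>

definition satisfied :: "('f, 'r, 'm) struct \<Rightarrow> (nat \<Rightarrow> 'm) \<Rightarrow> ('f, 'r) fm set \<Rightarrow> bool" where
  "satisfied M e \<Gamma> \<longleftrightarrow> range e \<subseteq> univ M \<and> (\<forall>\<phi> \<in> \<Gamma>. sat M e \<phi>)"

lemma fv_Conj_bound:
  assumes "finite S"
  obtains K where "K \<ge> k" "fv (Conj S) \<subseteq> {..<K}"
proof -
  obtain K where "\<forall>i \<in> fv (Conj S). i < K"
    using finite_nat_set_iff_bounded finite_fv by blast
  then have "fv (Conj S) \<subseteq> {..<max k K}" by (auto simp: less_max_iff_disj)
  then show ?thesis using that[of "max k K"] by simp
qed

text \<open>The existential closure of the conjunction is a sentence, so its truth passes from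
  \<open>N\<close> to \<open>M\<close>, and witnesses for it in \<open>M\<close> give the
  assignment.\<close>

lemma finite_satisfied_transfer:
  fixes N :: "('f, 'r, 'n) struct" and M :: "('f, 'r, 'm) struct"
  assumes equiv: "\<And>\<sigma>. \<sigma> \<in> sentences L \<Longrightarrow> holds N \<sigma> [] \<Longrightarrow> holds M \<sigma> []"
    and M: "univ M \<noteq> {}" and S: "finite S" "\<And>\<phi>. \<phi> \<in> S \<Longrightarrow> wf_fm L \<phi>"
    and e: "satisfied N e S"
  shows "\<exists>e'. satisfied M e' S"
proof -
  obtain K where K: "fv (Conj S) \<subseteq> {..<K}" using fv_Conj_bound[OF S(1), of 0] by blast
  define \<sigma> where "\<sigma> = exs [0..<K] (Conj S)"
  have \<sigma>: "\<sigma> \<in> sentences L"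
    using K S by (auto simp: \<sigma>_def formulas_def wf_exs fv_exs wf_Conj)
  have N: "univ N \<noteq> {}" using e by (auto simp: satisfied_def)
  have "holds N \<sigma> [] \<longleftrightarrow> sat N e \<sigma>" using \<sigma> by (intro holds_iff_sat) auto
  also have "\<dots>"
    using e unfolding \<sigma>_def sat_exs
    by (intro exI[of _ e]) (auto simp: sat_Conj[OF S(1) N] satisfied_def)
  finally have "holds M \<sigma> []" by (rule equiv[OF \<sigma>])
  then obtain e' where e': "\<forall>i \<in> {0..<K}. e' i \<in> univ M" "sat M e' (Conj S)"
    unfolding holds_def \<sigma>_def sat_exs set_upt by blast
  \<comment> \<open>The variables from \<open>K\<close> on are not free in \<open>S\<close>; any
    element of the universe serves as their value.\<close>
  obtain m where m: "m \<in> univ M" using M by blast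
  define e2 where "e2 i = (if i < K then e' i else m)" for i
  have "sat M e2 (Conj S)"
    using e'(2) K by (subst sat_cong[of _ e2 e']) (auto simp: e2_def)
  then have "satisfied M e2 S"
    using e'(1) m by (auto simp: satisfied_def sat_Conj[OF S(1) M] e2_def)
  then show ?thesis by blast
qed

section \<open>Realizing countably many variables in a saturated structure\<close>

lemma finite_small:
  fixes L :: "('f, 'r) lang"
  assumes "finite A"
  shows "small L A"
proof -
  have "inj (\<lambda>i. Eq (Var i) (Var i) :: ('f, 'r) fm)" by (auto intro: injI)
  then have "infinite (range (\<lambda>i. Eq (Var i) (Var i) :: ('f, 'r) fm))"
    by (simp add: finite_image_iff)
  moreover have "range (\<lambda>i. Eq (Var i) (Var i)) \<subseteq> {\<phi>. wf_fm L \<phi>}" by auto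
  ultimately have "infinite {\<phi>. wf_fm L \<phi>}" using finite_subset by blast
  then show ?thesis unfolding small_def
    using assms card_of_ordLeq_finite ordLeq_total[OF card_of_Well_order card_of_Well_order]
    by blast
qed

text \<open>The invariant of a recursion that fixes the values of the variables one at a time: only
  the values of \<open>e\<close> below \<open>k\<close> count, and they must be compatible with
  every finite part of \<open>\<Gamma>\<close>.\<close>

definition extendable ::
  "('f, 'r, 'm) struct \<Rightarrow> ('f, 'r) fm set \<Rightarrow> nat \<Rightarrow> (nat \<Rightarrow> 'm) \<Rightarrow> bool" where
  "extendable M \<Gamma> k e \<longleftrightarrow>
     (\<forall>S \<subseteq> \<Gamma>. finite S \<longrightarrow> (\<exists>e'. (\<forall>i<k. e' i = e i) \<and> satisfied M e' S))"

text \<open>The value of variable \<open>k\<close> has to realize a type over the finitely many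
  earlier values: for each finite part of \<open>\<Gamma>\<close>, the formula saying that these
  values together with the new one extend to a solution of it. By the invariant this type is
  finitely satisfiable, and saturation realizes it.\<close>

lemma extendable_step:
  fixes M :: "('f, 'r, 'm) struct"
  assumes sat: "saturated L M" and wf: "\<And>\<phi>. \<phi> \<in> \<Gamma> \<Longrightarrow> wf_fm L \<phi>"
    and e: "extendable M \<Gamma> k e"
  shows "\<exists>x. extendable M \<Gamma> (Suc k) (e(k := x))"
proof -
  have ne: "univ M \<noteq> {}" and A: "e ` {..<k} \<subseteq> univ M"
    using e[unfolded extendable_def, rule_format, of "{}"]
    by (auto simp: satisfied_def) (metis rangeI subsetD)
  \<comment> \<open>moves the variable \<open>k\<close> to position \<open>0\<close>, in front of the parameters \<open>e 0, \<dots>, e (k - 1)\<close>\<close>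
  define g where "g i = (if i = k then 0 else Suc i)" for i
  have g: "inj_on g {..<Suc k}" by (auto simp: inj_on_def g_def)
  define K where "K S = (SOME K. K \<ge> Suc k \<and> fv (Conj S) \<subseteq> {..<K})" for S :: "('f, 'r) fm set"
  have K: "K S \<ge> Suc k" "fv (Conj S) \<subseteq> {..<K S}" if "finite S" for S
    using someI_ex[of "\<lambda>K. K \<ge> Suc k \<and> fv (Conj S) \<subseteq> {..<K}"] fv_Conj_bound[OF that, of "Suc k"]
    unfolding K_def by blast+
  \<comment> \<open>Says of the variables up to \<open>k\<close> that they extend to a solution of
    \<open>S\<close>; the bound \<open>K S\<close> ensures that all later free variables are
    quantified.\<close>
  define \<chi> where "\<chi> S = exs [Suc k..<K S] (Conj S)" for S :: "('f, 'r) fm set"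
  define b where "b = map e [0..<k]"
  have set_b: "set b = e ` {..<k}" by (auto simp: b_def)
  have \<chi>: "\<chi> S \<in> formulas L (Suc k)" if "finite S" "S \<subseteq> \<Gamma>" for S
    using K(2)[OF that(1)] wf that
    by (auto simp: \<chi>_def formulas_def wf_exs fv_exs wf_Conj)
  have holds: "holds M (inst g (Suc k) (\<chi> S)) ([x] @ b) \<longleftrightarrow>
      (\<exists>e'. (\<forall>i<Suc k. e' i = (e(k := x)) i) \<and> satisfied M e' S)"
    if S: "finite S" "S \<subseteq> \<Gamma>" and x: "x \<in> univ M" for S x
  proof -
    define E where "E i = (if i < Suc k then ([x] @ b) ! i else undefined)" for i
    have "inst g (Suc k) (\<chi> S) \<in> formulas L (length ([x] @ b))"
      using inst_formula[OF g \<chi>[OF S]] by (auto simp: formulas_def b_def g_def)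
    then have "holds M (inst g (Suc k) (\<chi> S)) ([x] @ b) \<longleftrightarrow> sat M E (inst g (Suc k) (\<chi> S))"
      by (rule holds_iff_sat) (auto simp: E_def b_def)
    also have "\<dots> \<longleftrightarrow> holds M (\<chi> S) (map (\<lambda>i. E (g i)) [0..<Suc k])"
      by (rule sat_inst[OF g \<chi>[OF S]])
    also have "\<dots> \<longleftrightarrow> sat M (e(k := x)) (\<chi> S)"
      using \<chi>[OF S] by (intro holds_iff_sat) (auto simp: E_def b_def g_def nth_append less_Suc_eq)
    also have "\<dots> \<longleftrightarrow> (\<exists>e'. (\<forall>i<Suc k. e' i = (e(k := x)) i) \<and> satisfied M e' S)" (is "?A \<longleftrightarrow> ?B")
    proof
      assume ?A
      then obtain e' where e': "\<And>i. i \<notin> {Suc k..<K S} \<Longrightarrow> e' i = (e(k := x)) i"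
        "\<And>i. i \<in> {Suc k..<K S} \<Longrightarrow> e' i \<in> univ M" "sat M e' (Conj S)"
        unfolding \<chi>_def sat_exs set_upt by blast
      \<comment> \<open>From \<open>K S\<close> on \<open>e'\<close> agrees with \<open>e\<close>,
        which may leave the universe there; \<open>x\<close> is taken instead.\<close>
      define e2 where "e2 i = (if i < K S then e' i else x)" for i
      have "sat M e2 (Conj S)"
        using e'(3) K(2)[OF S(1)] by (subst sat_cong[of _ e2 e']) (auto simp: e2_def)
      moreover have "e2 i \<in> univ M" for i
      proof (cases "i < Suc k")
        case True
        then have "(e(k := x)) i \<in> univ M" using A x by auto
        with True show ?thesis using e'(1)[of i] x by (simp add: e2_def)
      next
        case False
        then show ?thesis using e'(2)[of i] x by (simp add: e2_def)
      qed
      moreover have "e2 i = (e(k := x)) i" if "i < Suc k" for i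
        using that K(1)[OF S(1)] e'(1)[of i] by (simp add: e2_def)
      ultimately show ?B
        by (intro exI[of _ e2]) (auto simp: satisfied_def sat_Conj[OF S(1) ne])
    next
      assume ?B
      then obtain e' where e': "\<And>i. i < Suc k \<Longrightarrow> e' i = (e(k := x)) i" "satisfied M e' S"
        by blast
      \<comment> \<open>Conversely \<open>sat_exs\<close> demands agreement with
        \<open>e(k := x)\<close> outside the block, so the values from \<open>K S\<close> on are
        reset.\<close>
      define e2 where "e2 i = (if i < K S then e' i else (e(k := x)) i)" for i
      have "sat M e2 (Conj S)"
        using e'(2) K(2)[OF S(1)]
        by (subst sat_cong[of _ e2 e']) (auto simp: e2_def satisfied_def sat_Conj[OF S(1) ne])
      moreover have "e2 i \<in> univ M" if "i \<in> {Suc k..<K S}" for i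
        using e'(2) that by (auto simp: e2_def satisfied_def)
      moreover have "e2 i = (e(k := x)) i" if "i \<notin> {Suc k..<K S}" for i
        using that e'(1)[of i] by (auto simp: e2_def)
      ultimately show ?A unfolding \<chi>_def sat_exs by (intro exI[of _ e2]) auto
    qed
    finally show ?thesis .
  qed
  define \<Sigma> where "\<Sigma> = (\<lambda>S. (inst g (Suc k) (\<chi> S), b)) ` {S. finite S \<and> S \<subseteq> \<Gamma>}"
  have "consistent M 1 \<Sigma>"
    unfolding consistent_def
  proof (intro allI impI)
    fix \<Sigma>0 assume "\<Sigma>0 \<subseteq> \<Sigma>" "finite \<Sigma>0"
    then obtain F where F: "F \<subseteq> {S. finite S \<and> S \<subseteq> \<Gamma>}" "finite F"
      "\<Sigma>0 = (\<lambda>S. (inst g (Suc k) (\<chi> S), b)) ` F"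
      unfolding \<Sigma>_def by (meson finite_subset_image)
    \<comment> \<open>Finitely many conditions of the type follow from the single finite part
      \<open>\<Union>F\<close>, so the value at \<open>k\<close> of one solution meets them
      all.\<close>
    then have "finite (\<Union>F)" "\<Union>F \<subseteq> \<Gamma>" by auto
    then obtain e' where e': "\<forall>i<k. e' i = e i" "satisfied M e' (\<Union>F)"
      using e unfolding extendable_def by blast
    have x: "e' k \<in> univ M" using e'(2) by (auto simp: satisfied_def)
    have "holds M (inst g (Suc k) (\<chi> S)) ([e' k] @ b)" if "S \<in> F" for S
      using that F(1) e' by (subst holds[OF _ _ x]) (auto simp: satisfied_def less_Suc_eq intro!: exI[of _ e'])
    then show "\<exists>c \<in> tuples M 1. realizes M c \<Sigma>0"
      using x by (intro bexI[of _ "[e' k]"]) (auto simp: F(3) realizes_def tuples_def)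
  qed
  moreover have "\<Sigma> \<subseteq> formulas_over L 1 (e ` {..<k})"
    using inst_formula[OF g \<chi>]
    by (fastforce simp: \<Sigma>_def formulas_over_def set_b formulas_def b_def g_def subset_iff)
  moreover have "small L (e ` {..<k})" by (rule finite_small) simp
  ultimately obtain c where c: "c \<in> tuples M 1" "realizes M c \<Sigma>"
    using sat A unfolding saturated_def by blast
  then obtain x where x: "c = [x]" "x \<in> univ M"
    by (auto simp: tuples_def length_Suc_conv)
  have "extendable M \<Gamma> (Suc k) (e(k := x))"
    unfolding extendable_def
  proof (intro allI impI)
    fix S assume S: "S \<subseteq> \<Gamma>" "finite S"
    then have "holds M (inst g (Suc k) (\<chi> S)) ([x] @ b)"
      using c(2) unfolding realizes_def \<Sigma>_def x(1) by fast
    then show "\<exists>e'. (\<forall>i<Suc k. e' i = (e(k := x)) i) \<and> satisfied M e' S"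
      using holds[OF S(2,1) x(2)] by blast
  qed
  then show ?thesis ..
qed

text \<open>Iterating the extension step gives assignments that stabilize at each variable. A single
  formula has finitely many free variables, so a finite stage already ensures that it holds in the
  limit.\<close>

lemma saturated_satisfied:
  fixes M :: "('f, 'r, 'm) struct"
  assumes sat: "saturated L M" and wf: "\<And>\<phi>. \<phi> \<in> \<Gamma> \<Longrightarrow> wf_fm L \<phi>"
    and fin: "\<And>S. S \<subseteq> \<Gamma> \<Longrightarrow> finite S \<Longrightarrow> \<exists>e. satisfied M e S"
  shows "\<exists>e. satisfied M e \<Gamma>"
proof -
  have "\<exists>f. \<forall>k. extendable M \<Gamma> k (f k) \<and> (\<exists>x. f (Suc k) = (f k)(k := x))"
  proof (rule dependent_nat_choice)
    show "\<exists>e. extendable M \<Gamma> 0 e" using fin by (auto simp: extendable_def)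
    show "\<exists>e'. extendable M \<Gamma> (Suc k) e' \<and> (\<exists>x. e' = e(k := x))" if "extendable M \<Gamma> k e" for e k
      using extendable_step[OF sat wf that] by blast
  qed
  then obtain f where f: "\<And>k. extendable M \<Gamma> k (f k)" "\<And>k. \<exists>x. f (Suc k) = (f k)(k := x)"
    by blast
  \<comment> \<open>The value at \<open>i\<close> is set in passing from stage \<open>i\<close> to
    stage \<open>Suc i\<close> and never changes afterwards.\<close>
  define s where "s i = f (Suc i) i" for i
  have fs: "f k i = s i" if "i < k" for i k
    using that
  proof (induction k)
    case (Suc k)
    then show ?case using f(2)[of k] by (cases "i = k") (auto simp: s_def)
  qed simp
  have ext: "\<exists>e'. (\<forall>i<k. e' i = s i) \<and> satisfied M e' S" if "S \<subseteq> \<Gamma>" "finite S" for S k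
    using f(1)[of k] that fs[of _ k] unfolding extendable_def by auto
  have "s i \<in> univ M" for i
    using ext[of "{}" "Suc i"] by (auto simp: satisfied_def) (metis lessI rangeI subsetD)
  moreover have "sat M s \<phi>" if \<phi>: "\<phi> \<in> \<Gamma>" for \<phi>
  proof -
    obtain k where k: "\<forall>i \<in> fv \<phi>. i < k" using finite_nat_set_iff_bounded finite_fv by blast
    obtain e' where "\<forall>i<k. e' i = s i" "satisfied M e' {\<phi>}"
      using ext[of "{\<phi>}" k] \<phi> by auto
    then show ?thesis using k sat_cong[of \<phi> e' s M] by (auto simp: satisfied_def)
  qed
  ultimately show ?thesis by (auto simp: satisfied_def intro!: exI[of _ s])
qed

section \<open>ATP patterns\<close>

abbreviation antichain :: "bool list set \<Rightarrow> bool" where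
  "antichain X \<equiv> pairwise (\<lambda>\<eta> \<nu>. \<eta> \<parallel> \<nu>) X"

text \<open>The conditions of ATP relativized to the nodes in \<open>D\<close>. Consistency is
  replaced by a common solution for finite antichains, so that each condition is first
  order.\<close>

definition pattern ::
  "('f, 'r, 'm) struct \<Rightarrow> nat \<Rightarrow> nat \<Rightarrow> ('f, 'r) fm \<Rightarrow> bool list set \<Rightarrow> (bool list \<Rightarrow> 'm list) \<Rightarrow> bool"
where
  "pattern M n m \<phi> D a \<longleftrightarrow>
     (\<forall>\<eta>. a \<eta> \<in> tuples M m) \<and>
     (\<forall>X \<subseteq> D. finite X \<and> antichain X \<longrightarrow> (\<exists>c \<in> tuples M n. \<forall>\<eta> \<in> X. holds M \<phi> (c @ a \<eta>))) \<and>
     (\<forall>\<eta> \<in> D. \<forall>\<nu> \<in> D. strict_prefix \<eta> \<nu> \<longrightarrow>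
        \<not> (\<exists>c \<in> tuples M n. holds M \<phi> (c @ a \<eta>) \<and> holds M \<phi> (c @ a \<nu>)))"

lemma pattern_antichain:
  assumes "pattern M n m \<phi> D a" "X \<subseteq> D" "finite X" "antichain X"
  obtains c where "c \<in> tuples M n" "\<And>\<eta>. \<eta> \<in> X \<Longrightarrow> holds M \<phi> (c @ a \<eta>)"
proof -
  have "\<exists>c \<in> tuples M n. \<forall>\<eta> \<in> X. holds M \<phi> (c @ a \<eta>)"
    using assms by (simp add: pattern_def)
  then show ?thesis using that by blast
qed

lemma pattern_prefix:
  assumes "pattern M n m \<phi> D a" "\<eta> \<in> D" "\<nu> \<in> D" "strict_prefix \<eta> \<nu>"
    "c \<in> tuples M n" "holds M \<phi> (c @ a \<eta>)"
  shows "\<not> holds M \<phi> (c @ a \<nu>)"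
  using assms by (simp add: pattern_def)

lemma pattern_mono:
  assumes "pattern M n m \<phi> D a" "D' \<subseteq> D"
  shows "pattern M n m \<phi> D' a"
  unfolding pattern_def
proof (intro conjI allI impI ballI)
  show "a \<eta> \<in> tuples M m" for \<eta> using assms(1) by (simp add: pattern_def)
  show "\<exists>c \<in> tuples M n. \<forall>\<eta> \<in> X. holds M \<phi> (c @ a \<eta>)"
    if X: "X \<subseteq> D'" "finite X \<and> antichain X" for X
  proof -
    have "X \<subseteq> D" using X(1) assms(2) by blast
    then show ?thesis using pattern_antichain[OF assms(1)] X(2) by metis
  qed
  show "\<not> (\<exists>c \<in> tuples M n. holds M \<phi> (c @ a \<eta>) \<and> holds M \<phi> (c @ a \<nu>))"
    if "\<eta> \<in> D'" "\<nu> \<in> D'" "strict_prefix \<eta> \<nu>" for \<eta> \<nu>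
    using pattern_prefix[OF assms(1) subsetD[OF assms(2) that(1)] subsetD[OF assms(2) that(2)] that(3)]
    by metis
qed

section \<open>Patterns as sets of formulas about the parameters\<close>

text \<open>The \<open>n\<close> variables of \<open>x\<close> are shared by all nodes, whereas
  every node owns a block of \<open>m\<close> parameter variables. Thus one assignment encodes the
  parameters of the whole tree.\<close>

definition node_map :: "nat \<Rightarrow> nat \<Rightarrow> bool list \<Rightarrow> nat \<Rightarrow> nat" where
  "node_map n m \<eta> i = (if i < n then i else i + m * to_nat \<eta>)"

definition node_tuple :: "nat \<Rightarrow> nat \<Rightarrow> (nat \<Rightarrow> 'm) \<Rightarrow> bool list \<Rightarrow> 'm list" where
  "node_tuple n m e \<eta> = map (\<lambda>j. e (n + j + m * to_nat \<eta>)) [0..<m]"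

definition common_solution :: "nat \<Rightarrow> nat \<Rightarrow> ('f, 'r) fm \<Rightarrow> bool list set \<Rightarrow> ('f, 'r) fm" where
  "common_solution n m \<phi> X = exs [0..<n] (Conj ((\<lambda>\<eta>. inst (node_map n m \<eta>) (n + m) \<phi>) ` X))"

definition pattern_formulas ::
  "nat \<Rightarrow> nat \<Rightarrow> ('f, 'r) fm \<Rightarrow> bool list set \<Rightarrow> ('f, 'r) fm set" where
  "pattern_formulas n m \<phi> D =
     {common_solution n m \<phi> X |X. X \<subseteq> D \<and> finite X \<and> antichain X} \<union>
     {Neg (common_solution n m \<phi> {\<eta>, \<nu>}) |\<eta> \<nu>. \<eta> \<in> D \<and> \<nu> \<in> D \<and> strict_prefix \<eta> \<nu>}"

lemma inj_node_map: "inj_on (node_map n m \<eta>) {..<n + m}"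
  by (auto simp: inj_on_def node_map_def split: if_splits)

lemma sat_common_solution:
  assumes \<phi>: "\<phi> \<in> formulas L (n + m)" and X: "finite X" and M: "univ M \<noteq> {}"
  shows "sat M e (common_solution n m \<phi> X) \<longleftrightarrow>
    (\<exists>c \<in> tuples M n. \<forall>\<eta> \<in> X. holds M \<phi> (c @ node_tuple n m e \<eta>))"
proof -
  have split: "map (\<lambda>i. e (node_map n m \<eta> i)) [0..<n + m] = map e [0..<n] @ node_tuple n m e \<eta>"
    for e \<eta>
    by (rule nth_equalityI) (auto simp: node_map_def node_tuple_def nth_append)
  \<comment> \<open>The parameters use only variables from \<open>n\<close> on, so quantifying over
    the block \<open>x\<close> leaves them as they are.\<close>
  have nt: "node_tuple n m (\<lambda>i. if i < n then undefined else e i) \<eta> = node_tuple n m e \<eta>"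
    for e \<eta>
    by (simp add: node_tuple_def)
  have "sat M e (exs [0..<0 + n] (Conj ((\<lambda>\<eta>. inst (node_map n m \<eta>) (n + m) \<phi>) ` X))) \<longleftrightarrow>
    (\<exists>c \<in> tuples M n. \<forall>\<eta> \<in> X. holds M \<phi>
        (c @ node_tuple n m (\<lambda>i. if i \<in> {0..<0 + n} then undefined else e i) \<eta>))"
    by (rule sat_exs_upt)
      (simp add: sat_Conj[OF finite_imageI[OF X] M] sat_inst[OF inj_node_map \<phi>] split nt)
  then show ?thesis by (simp add: common_solution_def nt)
qed

lemma wf_common_solution:
  assumes "\<phi> \<in> formulas L (n + m)" "finite X"
  shows "wf_fm L (common_solution n m \<phi> X)"
  using assms by (auto simp: common_solution_def wf_exs wf_Conj inst_formula[OF inj_node_map])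

lemma wf_pattern_formulas:
  "\<phi> \<in> formulas L (n + m) \<Longrightarrow> \<psi> \<in> pattern_formulas n m \<phi> D \<Longrightarrow> wf_fm L \<psi>"
  by (auto simp: pattern_formulas_def wf_common_solution)

text \<open>Each condition on the encoded parameters is one formula; this makes patterns accessible
  to elementary equivalence and to saturation.\<close>

lemma satisfied_pattern_formulas:
  assumes "\<phi> \<in> formulas L (n + m)" "range e \<subseteq> univ M"
  shows "satisfied M e (pattern_formulas n m \<phi> D) \<longleftrightarrow> pattern M n m \<phi> D (node_tuple n m e)"
proof -
  have M: "univ M \<noteq> {}" using assms(2) by auto
  have "node_tuple n m e \<eta> \<in> tuples M m" for \<eta>
    using assms(2) by (auto simp: node_tuple_def tuples_def)
  moreover have "(\<forall>\<psi> \<in> pattern_formulas n m \<phi> D. sat M e \<psi>) \<longleftrightarrow>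
     (\<forall>X. X \<subseteq> D \<and> finite X \<and> antichain X \<longrightarrow> sat M e (common_solution n m \<phi> X)) \<and>
     (\<forall>\<eta> \<in> D. \<forall>\<nu> \<in> D. strict_prefix \<eta> \<nu> \<longrightarrow> \<not> sat M e (common_solution n m \<phi> {\<eta>, \<nu>}))"
  proof -
    have 1: "(\<forall>\<psi> \<in> {f X |X. P X}. Q \<psi>) \<longleftrightarrow> (\<forall>X. P X \<longrightarrow> Q (f X))"
      for f P and Q :: "'z \<Rightarrow> bool"
      by blast
    have 2: "(\<forall>\<psi> \<in> {f \<eta> \<nu> |\<eta> \<nu>. P \<eta> \<nu>}. Q \<psi>) \<longleftrightarrow> (\<forall>\<eta> \<nu>. P \<eta> \<nu> \<longrightarrow> Q (f \<eta> \<nu>))"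
      for f P and Q :: "'z \<Rightarrow> bool"
      by blast
    show ?thesis unfolding pattern_formulas_def ball_Un 1 2 sat.simps by meson
  qed
  moreover have "(\<forall>X. X \<subseteq> D \<and> finite X \<and> antichain X \<longrightarrow> sat M e (common_solution n m \<phi> X)) \<longleftrightarrow>
     (\<forall>X \<subseteq> D. finite X \<and> antichain X \<longrightarrow>
        (\<exists>c \<in> tuples M n. \<forall>\<eta> \<in> X. holds M \<phi> (c @ node_tuple n m e \<eta>)))"
    by (simp add: sat_common_solution[OF assms(1) _ M] cong: conj_cong imp_cong) blast
  moreover have "sat M e (common_solution n m \<phi> {\<eta>, \<nu>}) \<longleftrightarrow> (\<exists>c \<in> tuples M n.
     holds M \<phi> (c @ node_tuple n m e \<eta>) \<and> holds M \<phi> (c @ node_tuple n m e \<nu>))" for \<eta> \<nu>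
    using sat_common_solution[OF assms(1) _ M, of "{\<eta>, \<nu>}"] by simp
  ultimately show ?thesis
    unfolding satisfied_def pattern_def using assms(2) by simp
qed

lemma node_tuple_surj:
  assumes "0 < m" "\<And>\<eta>. a \<eta> \<in> tuples M m"
  obtains e where "range e \<subseteq> univ M" "node_tuple n m e = a"
proof -
  \<comment> \<open>Inverts the numbering \<open>n + j + m * to_nat \<eta>\<close> by division by
    \<open>m\<close>. Below \<open>n\<close> the truncated difference is \<open>0\<close>, so these
    values lie in the universe as well.\<close>
  define e where "e i = a (from_nat ((i - n) div m)) ! ((i - n) mod m)" for i
  have "range e \<subseteq> univ M"
  proof
    fix y assume "y \<in> range e"
    then obtain i where "y = a (from_nat ((i - n) div m)) ! ((i - n) mod m)" by (auto simp: e_def)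
    moreover have "(i - n) mod m < m" using assms(1) by simp
    ultimately show "y \<in> univ M" using assms(2)[of "from_nat ((i - n) div m)"]
      by (auto simp: tuples_def)
  qed
  moreover have "node_tuple n m e \<eta> = a \<eta>" for \<eta>
    using assms(2)[of \<eta>] by (intro nth_equalityI) (auto simp: node_tuple_def e_def tuples_def)
  ultimately show ?thesis using that by blast
qed

section \<open>Finite levels of the tree\<close>

definition level :: "nat \<Rightarrow> bool list set" where
  "level d = {\<eta>. length \<eta> < d}"

lemma finite_level: "finite (level d)"
proof -
  have "finite {\<eta> :: bool list. set \<eta> \<subseteq> UNIV \<and> length \<eta> \<le> d}"
    by (rule finite_lists_length_le) simp
  then show ?thesis by (rule finite_subset[rotated]) (auto simp: level_def)
qed

lemma finite_pattern_formulas: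
  assumes "finite D"
  shows "finite (pattern_formulas n m \<phi> D)"
proof -
  have "pattern_formulas n m \<phi> D \<subseteq>
    common_solution n m \<phi> ` Pow D \<union> (\<lambda>(\<eta>, \<nu>). Neg (common_solution n m \<phi> {\<eta>, \<nu>})) ` (D \<times> D)"
    by (auto simp: pattern_formulas_def)
  then show ?thesis by (rule finite_subset) (simp add: assms)
qed

lemma finite_subset_level:
  assumes "finite X"
  obtains d where "X \<subseteq> level d"
proof -
  obtain d where "\<forall>k \<in> length ` X. k < d"
    using assms finite_nat_set_iff_bounded[of "length ` X"] by auto
  then show ?thesis using that[of d] by (auto simp: level_def)
qed

lemma level_mono: "d \<le> d' \<Longrightarrow> level d \<subseteq> level d'"
  by (auto simp: level_def)

lemma pattern_formulas_mono: "D \<subseteq> D' \<Longrightarrow> pattern_formulas n m \<phi> D \<subseteq> pattern_formulas n m \<phi> D'"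
  unfolding pattern_formulas_def by blast

text \<open>Every formula speaks of finitely many nodes, and the levels exhaust the tree.\<close>

lemma finite_subset_pattern_formulas:
  assumes "finite S" "S \<subseteq> pattern_formulas n m \<phi> UNIV"
  shows "\<exists>d. S \<subseteq> pattern_formulas n m \<phi> (level d)"
  using assms
proof (induction S)
  case (insert \<psi> S)
  then obtain d where d: "S \<subseteq> pattern_formulas n m \<phi> (level d)" by auto
  obtain d' where d': "\<psi> \<in> pattern_formulas n m \<phi> (level d')"
  proof -
    have "\<psi> \<in> pattern_formulas n m \<phi> UNIV" using insert.prems by simp
    then consider X where "finite X" "antichain X" "\<psi> = common_solution n m \<phi> X"
      | \<eta> \<nu> where "strict_prefix \<eta> \<nu>" "\<psi> = Neg (common_solution n m \<phi> {\<eta>, \<nu>})"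
      unfolding pattern_formulas_def by blast
    then show ?thesis
    proof cases
      case 1
      obtain d' where "X \<subseteq> level d'" using finite_subset_level[OF 1(1)] .
      then have "\<psi> \<in> pattern_formulas n m \<phi> (level d')"
        using 1 unfolding pattern_formulas_def by blast
      then show ?thesis by (rule that)
    next
      case 2
      obtain d' where "{\<eta>, \<nu>} \<subseteq> level d'" using finite_subset_level[of "{\<eta>, \<nu>}"] by auto
      then have "\<psi> \<in> pattern_formulas n m \<phi> (level d')"
        using 2 unfolding pattern_formulas_def by blast
      then show ?thesis by (rule that)
    qed
  qed
  have "insert \<psi> S \<subseteq> pattern_formulas n m \<phi> (level (max d d'))"
    using d d' pattern_formulas_mono[OF level_mono[of d "max d d'"], of n m \<phi>]
      pattern_formulas_mono[OF level_mono[of d' "max d d'"], of n m \<phi>] by auto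
  then show ?case ..
qed auto

text \<open>On a level there are only finitely many pattern formulas, so their joint satisfiability
  is a first order property of \<open>N\<close> that passes to \<open>M\<close>.\<close>

lemma pattern_transfer:
  fixes N :: "('f, 'r, 'n) struct" and M :: "('f, 'r, 'm) struct"
  assumes equiv: "\<And>\<sigma>. \<sigma> \<in> sentences L \<Longrightarrow> holds N \<sigma> [] \<Longrightarrow> holds M \<sigma> []"
    and M: "univ M \<noteq> {}" and \<phi>: "\<phi> \<in> formulas L (n + m)" "0 < m"
    and a: "pattern N n m \<phi> (level d) a"
  shows "\<exists>e. satisfied M e (pattern_formulas n m \<phi> (level d))"
proof -
  have "a \<eta> \<in> tuples N m" for \<eta> using a by (simp add: pattern_def)
  then obtain e where e: "range e \<subseteq> univ N" "node_tuple n m e = a"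
    by (rule node_tuple_surj[OF \<phi>(2)])
  then have "satisfied N e (pattern_formulas n m \<phi> (level d))"
    using a by (simp add: satisfied_pattern_formulas[OF \<phi>(1)])
  then have "\<exists>e'. satisfied M e' (pattern_formulas n m \<phi> (level d))"
    by (intro finite_satisfied_transfer[OF equiv M finite_pattern_formulas[OF finite_level]
        wf_pattern_formulas[OF \<phi>(1)]])
  then show ?thesis .
qed

section \<open>From patterns to ATP\<close>

text \<open>Finitely many instances taken from an antichain come from a finite subset
  \<open>Y\<close>, again an antichain. A pair of instances is itself finite, so its consistency
  would give a common solution.\<close>

lemma ATP_formula_if_pattern:
  assumes \<phi>: "\<phi> \<in> formulas L (n + m)" and a: "pattern M n m \<phi> UNIV a"
  shows "ATP_formula L M n m \<phi>"
proof -
  have "consistent M n {(\<phi>, a \<eta>) |\<eta>. \<eta> \<in> X}" if X: "antichain X" for X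
    unfolding consistent_def
  proof (intro allI impI)
    fix \<Sigma>0 assume \<Sigma>0: "\<Sigma>0 \<subseteq> {(\<phi>, a \<eta>) |\<eta>. \<eta> \<in> X}" "finite \<Sigma>0"
    then have "\<Sigma>0 \<subseteq> (\<lambda>\<eta>. (\<phi>, a \<eta>)) ` X" by blast
    then obtain Y where Y: "Y \<subseteq> X" "finite Y" "\<Sigma>0 = (\<lambda>\<eta>. (\<phi>, a \<eta>)) ` Y"
      using \<Sigma>0(2) by (meson finite_subset_image)
    then have "antichain Y" using X pairwise_subset by blast
    then obtain c where "c \<in> tuples M n" "\<And>\<eta>. \<eta> \<in> Y \<Longrightarrow> holds M \<phi> (c @ a \<eta>)"
      using pattern_antichain[OF a subset_UNIV Y(2)] by blast
    then show "\<exists>c \<in> tuples M n. realizes M c \<Sigma>0" by (auto simp: Y(3) realizes_def)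
  qed
  moreover have "\<not> consistent M n {(\<phi>, a \<eta>), (\<phi>, a \<nu>)}" if "prefix \<eta> \<nu>" "\<eta> \<noteq> \<nu>" for \<eta> \<nu>
  proof
    assume "consistent M n {(\<phi>, a \<eta>), (\<phi>, a \<nu>)}"
    then obtain c where "c \<in> tuples M n" "realizes M c {(\<phi>, a \<eta>), (\<phi>, a \<nu>)}"
      unfolding consistent_def by (meson finite.emptyI finite.insertI order_refl)
    then show False
      using pattern_prefix[OF a, of \<eta> \<nu> c] that by (simp add: realizes_def strict_prefix_def)
  qed
  moreover have "\<forall>\<eta>. a \<eta> \<in> tuples M m" using a by (simp add: pattern_def)
  ultimately show ?thesis
    unfolding ATP_formula_def using \<phi> by (intro conjI exI[of _ a] allI impI; (elim conjE)?) simp_all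
qed

text \<open>Any finite part of the pattern formulas for the whole tree lives on one level, where
  \<open>N\<close> provides a pattern; saturation joins the levels.\<close>

lemma has_ATP_if_finite_patterns:
  fixes N :: "('f, 'r, 'n) struct" and M :: "('f, 'r, 'm) struct"
  assumes sat: "saturated L M"
    and equiv: "\<And>\<sigma>. \<sigma> \<in> sentences L \<Longrightarrow> holds N \<sigma> [] \<Longrightarrow> holds M \<sigma> []"
    and M: "univ M \<noteq> {}" and \<phi>: "\<phi> \<in> formulas L (n + m)" "0 < m"
    and a: "\<And>d. \<exists>a. pattern N n m \<phi> (level d) a"
  shows "has_ATP L M"
proof -
  have "\<exists>e. satisfied M e (pattern_formulas n m \<phi> UNIV)"
  proof (rule saturated_satisfied[OF sat wf_pattern_formulas[OF \<phi>(1)]])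
    fix S assume "S \<subseteq> pattern_formulas n m \<phi> UNIV" "finite S"
    then obtain d where d: "S \<subseteq> pattern_formulas n m \<phi> (level d)"
      using finite_subset_pattern_formulas by blast
    obtain a where "pattern N n m \<phi> (level d) a" using a by blast
    then obtain e where "satisfied M e (pattern_formulas n m \<phi> (level d))"
      using pattern_transfer[OF equiv M \<phi>] by blast
    then show "\<exists>e. satisfied M e S"
      using d by (intro exI[of _ e]) (auto simp: satisfied_def)
  qed
  then obtain e where "satisfied M e (pattern_formulas n m \<phi> UNIV)" ..
  then have "pattern M n m \<phi> UNIV (node_tuple n m e)"
    using satisfied_pattern_formulas[OF \<phi>(1)] by (auto simp: satisfied_def)
  then show ?thesis
    using ATP_formula_if_pattern[OF \<phi>(1)] unfolding has_ATP_def by blast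
qed

section \<open>Divisibility\<close>

lemma divisibility_pattern:
  assumes "finite D"
  obtains u v :: "bool list \<Rightarrow> nat"
  where "\<And>\<eta> \<nu>. \<nu> \<in> D \<Longrightarrow> strict_prefix \<eta> \<nu> \<Longrightarrow> v \<nu> dvd u \<eta>"
    and "\<And>X. X \<subseteq> D \<Longrightarrow> finite X \<Longrightarrow> antichain X \<Longrightarrow> \<exists>x. \<forall>\<eta> \<in> X. u \<eta> dvd x \<and> \<not> v \<eta> dvd x"
proof -
  obtain f :: "nat \<Rightarrow> nat" where f: "inj f" "range f \<subseteq> {p. prime p}"
    using infinite_countable_subset[OF primes_infinite] by blast
  define q where "q \<eta> = f (to_nat \<eta>)" for \<eta> :: "bool list"
  have prime_q: "prime (q \<eta>)" for \<eta> using f(2) by (auto simp: q_def)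
  have q_eq: "q \<eta> = q \<nu> \<longleftrightarrow> \<eta> = \<nu>" for \<eta> \<nu> using f(1) by (simp add: q_def inj_eq)
  define u where "u \<eta> = (\<Prod>\<nu> | \<nu> \<in> D \<and> strict_prefix \<eta> \<nu>. q \<nu>)" for \<eta>
  have fin: "finite {\<nu>. \<nu> \<in> D \<and> strict_prefix \<eta> \<nu>}" for \<eta> using assms by simp
  \<comment> \<open>A prime dividing the product divides, and hence equals, one of its prime
    factors; primes attached to different nodes differ.\<close>
  have dvd_u: "q \<nu> dvd u \<eta> \<longleftrightarrow> \<nu> \<in> D \<and> strict_prefix \<eta> \<nu>" for \<nu> \<eta>
    unfolding u_def prime_dvd_prod_iff[OF fin prime_q]
    using primes_dvd_imp_eq[OF prime_q prime_q] q_eq by auto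
  show ?thesis
  proof (rule that[of q u])
    show "q \<nu> dvd u \<eta>" if "\<nu> \<in> D" "strict_prefix \<eta> \<nu>" for \<eta> \<nu>
      using that by (simp add: dvd_u)
    fix X assume X: "X \<subseteq> D" "finite X" "antichain X"
    have "\<not> q \<eta> dvd (\<Prod>\<nu>\<in>X. u \<nu>)" if "\<eta> \<in> X" for \<eta>
    proof
      assume "q \<eta> dvd (\<Prod>\<nu>\<in>X. u \<nu>)"
      \<comment> \<open>By primality \<open>q \<eta>\<close> divides some factor
        \<open>u \<nu>\<close>, which makes \<open>\<nu>\<close> a proper initial segment of
        \<open>\<eta>\<close> inside the antichain.\<close>
      then obtain \<nu> where "\<nu> \<in> X" "strict_prefix \<nu> \<eta>"
        by (auto simp: prime_dvd_prod_iff[OF X(2) prime_q] dvd_u)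
      then show False using X(3) that by (auto simp: pairwise_def strict_prefix_def)
    qed
    moreover have "u \<eta> dvd (\<Prod>\<nu>\<in>X. u \<nu>)" if "\<eta> \<in> X" for \<eta>
      using X(2) that by (rule dvd_prodI)
    ultimately show "\<exists>x. \<forall>\<eta> \<in> X. u \<eta> dvd x \<and> \<not> q \<eta> dvd x" by blast
  qed
qed

section \<open>The divisibility formula in Skolem arithmetic and in the integers\<close>

text \<open>With \<open>f\<close> as multiplication: variable \<open>1\<close> divides variable
  \<open>0\<close>, and variable \<open>2\<close> does not.\<close>

definition divides_fm :: "'f \<Rightarrow> ('f, 'r) fm" where
  "divides_fm f = And (Exists 3 (Eq (App f [Var 1, Var 3]) (Var 0)))
     (Neg (Exists 3 (Eq (App f [Var 2, Var 3]) (Var 0))))"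

lemma divides_fm_formula: "fun_ar L f = Some 2 \<Longrightarrow> divides_fm f \<in> formulas L (1 + 2)"
  by (auto simp: divides_fm_def formulas_def)

lemma holds_divides_fm:
  "holds M (divides_fm f) [x, u, v] \<longleftrightarrow>
     (\<exists>z \<in> univ M. fun_int M f [u, z] = x) \<and> \<not> (\<exists>z \<in> univ M. fun_int M f [v, z] = x)"
  by (simp add: holds_def divides_fm_def)

lemma tuples_1_iff: "c \<in> tuples M 1 \<longleftrightarrow> (\<exists>x \<in> univ M. c = [x])"
  by (auto simp: tuples_def length_Suc_conv)

lemma pattern_1_2I:
  assumes "\<And>\<eta>. u \<eta> \<in> univ M" "\<And>\<eta>. v \<eta> \<in> univ M"
    and "\<And>X. X \<subseteq> D \<Longrightarrow> finite X \<Longrightarrow> antichain X \<Longrightarrow>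
      \<exists>x \<in> univ M. \<forall>\<eta> \<in> X. holds M \<phi> [x, u \<eta>, v \<eta>]"
    and "\<And>\<eta> \<nu> x. \<eta> \<in> D \<Longrightarrow> \<nu> \<in> D \<Longrightarrow> strict_prefix \<eta> \<nu> \<Longrightarrow> x \<in> univ M \<Longrightarrow>
      holds M \<phi> [x, u \<eta>, v \<eta>] \<Longrightarrow> holds M \<phi> [x, u \<nu>, v \<nu>] \<Longrightarrow> False"
  shows "pattern M 1 2 \<phi> D (\<lambda>\<eta>. [u \<eta>, v \<eta>])"
  unfolding pattern_def
proof (intro conjI allI impI ballI)
  show "[u \<eta>, v \<eta>] \<in> tuples M 2" for \<eta> using assms(1,2) by (simp add: tuples_def)
  show "\<exists>c \<in> tuples M 1. \<forall>\<eta> \<in> X. holds M \<phi> (c @ [u \<eta>, v \<eta>])"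
    if X: "X \<subseteq> D" "finite X \<and> antichain X" for X
  proof -
    obtain x where "x \<in> univ M" "\<forall>\<eta> \<in> X. holds M \<phi> [x, u \<eta>, v \<eta>]"
      using assms(3)[OF X(1)] X(2) by blast
    then show ?thesis by (intro bexI[of _ "[x]"]) (auto simp: tuples_1_iff simp del: One_nat_def)
  qed
  show "\<not> (\<exists>c \<in> tuples M 1. holds M \<phi> (c @ [u \<eta>, v \<eta>]) \<and> holds M \<phi> (c @ [u \<nu>, v \<nu>]))"
    if "\<eta> \<in> D" "\<nu> \<in> D" "strict_prefix \<eta> \<nu>" for \<eta> \<nu>
    using assms(4)[OF that] by (auto simp: tuples_1_iff simp del: One_nat_def)
qed

lemma skolem_pattern:
  assumes "finite D"
  shows "\<exists>a. pattern skolem_struct 1 2 (divides_fm ()) D a"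
proof -
  obtain u v :: "bool list \<Rightarrow> nat" where uv:
    "\<And>\<eta> \<nu>. \<nu> \<in> D \<Longrightarrow> strict_prefix \<eta> \<nu> \<Longrightarrow> v \<nu> dvd u \<eta>"
    "\<And>X. X \<subseteq> D \<Longrightarrow> finite X \<Longrightarrow> antichain X \<Longrightarrow> \<exists>x. \<forall>\<eta> \<in> X. u \<eta> dvd x \<and> \<not> v \<eta> dvd x"
    by (rule divisibility_pattern[OF assms]) blast
  have holds: "holds skolem_struct (divides_fm ()) [x, y, z] \<longleftrightarrow> y dvd x \<and> \<not> z dvd x" for x y z
    by (auto simp: holds_divides_fm skolem_struct_def dvd_def eq_commute)
  have "pattern skolem_struct 1 2 (divides_fm ()) D (\<lambda>\<eta>. [u \<eta>, v \<eta>])"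
  proof (rule pattern_1_2I)
    fix X assume "X \<subseteq> D" "finite X" "antichain X"
    then show "\<exists>x \<in> univ skolem_struct. \<forall>\<eta> \<in> X. holds skolem_struct (divides_fm ()) [x, u \<eta>, v \<eta>]"
      unfolding holds using uv(2) by (simp add: skolem_struct_def)
  next
    fix \<eta> \<nu> x assume "\<nu> \<in> D" "strict_prefix \<eta> \<nu>"
    then show "holds skolem_struct (divides_fm ()) [x, u \<eta>, v \<eta>] \<Longrightarrow>
        holds skolem_struct (divides_fm ()) [x, u \<nu>, v \<nu>] \<Longrightarrow> False"
      unfolding holds using uv(1) dvd_trans by blast
  qed (simp_all add: skolem_struct_def)
  then show ?thesis by blast
qed

lemma int_ring_pattern:
  assumes "finite D"
  shows "\<exists>a. pattern int_ring 1 2 (divides_fm Times) D a"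
proof -
  obtain u v :: "bool list \<Rightarrow> nat" where uv:
    "\<And>\<eta> \<nu>. \<nu> \<in> D \<Longrightarrow> strict_prefix \<eta> \<nu> \<Longrightarrow> v \<nu> dvd u \<eta>"
    "\<And>X. X \<subseteq> D \<Longrightarrow> finite X \<Longrightarrow> antichain X \<Longrightarrow> \<exists>x. \<forall>\<eta> \<in> X. u \<eta> dvd x \<and> \<not> v \<eta> dvd x"
    by (rule divisibility_pattern[OF assms]) blast
  have holds: "holds int_ring (divides_fm Times) [x, y, z] \<longleftrightarrow> y dvd x \<and> \<not> z dvd x" for x y z
    by (auto simp: holds_divides_fm int_ring_def dvd_def eq_commute)
  have "pattern int_ring 1 2 (divides_fm Times) D (\<lambda>\<eta>. [int (u \<eta>), int (v \<eta>)])"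
  proof (rule pattern_1_2I)
    fix X assume "X \<subseteq> D" "finite X" "antichain X"
    then obtain x where "\<forall>\<eta> \<in> X. u \<eta> dvd x \<and> \<not> v \<eta> dvd x" using uv(2) by blast
    \<comment> \<open>The map \<open>int\<close> preserves and reflects divisibility, so the
      solution among the natural numbers remains one.\<close>
    then show "\<exists>x \<in> univ int_ring.
        \<forall>\<eta> \<in> X. holds int_ring (divides_fm Times) [x, int (u \<eta>), int (v \<eta>)]"
      unfolding holds by (intro bexI[of _ "int x"]) (simp_all add: int_ring_def)
  next
    fix \<eta> \<nu> x assume "\<nu> \<in> D" "strict_prefix \<eta> \<nu>"
    then have "int (v \<nu>) dvd int (u \<eta>)" using uv(1) by simp
    then show "holds int_ring (divides_fm Times) [x, int (u \<eta>), int (v \<eta>)] \<Longrightarrow>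
        holds int_ring (divides_fm Times) [x, int (u \<nu>), int (v \<nu>)] \<Longrightarrow> False"
      unfolding holds using dvd_trans by blast
  qed (simp_all add: int_ring_def)
  then show ?thesis by blast
qed

text \<open>\<open>T\<close> contains the complete theory of \<open>N\<close>, so the patterns may
  be looked for in the concrete structure \<open>N\<close> instead of the monster model.\<close>

lemma monster_model_has_ATP:
  fixes N :: "('f, 'r, 'n) struct" and M :: "('f, 'r, 'm) struct"
  assumes M: "monster_model L T M"
    and equiv: "\<And>\<sigma>. \<sigma> \<in> sentences L \<Longrightarrow> holds N \<sigma> [] \<Longrightarrow> \<sigma> \<in> T"
    and \<phi>: "\<phi> \<in> formulas L (n + m)" "0 < m"
    and a: "\<And>D. finite D \<Longrightarrow> \<exists>a. pattern N n m \<phi> D a"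
  shows "has_ATP L M"
proof (rule has_ATP_if_finite_patterns[where N = N, OF _ _ _ \<phi>])
  show "saturated L M" "univ M \<noteq> {}"
    using M by (auto simp: monster_model_def model_of_def structure_of_def)
  show "holds M \<sigma> []" if "\<sigma> \<in> sentences L" "holds N \<sigma> []" for \<sigma>
    using M equiv[OF that] by (auto simp: monster_model_def model_of_def)
  show "\<exists>a. pattern N n m \<phi> (level d) a" for d by (rule a[OF finite_level])
qed

section \<open>Interpretations of Skolem arithmetic\<close>

text \<open>The variable blocks of length \<open>i_dim \<iota>\<close> are \<open>x, u, v, z\<close>; block \<open>b\<close> divides \<open>x\<close>,
  with cofactor \<open>z\<close>.\<close>

definition interp_divides :: "('f, 'r, unit, 's) interp \<Rightarrow> nat \<Rightarrow> ('f, 'r) fm" where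
  "interp_divides \<iota> b = (let k = i_dim \<iota> in
     exs [3 * k..<3 * k + k]
       (And (inst (\<lambda>i. 3 * k + i) k (i_dom \<iota>))
            (inst (\<lambda>i. if i < k then b * k + i else if i < 2 * k then i + 2 * k else i - 2 * k)
               (3 * k) (i_fun \<iota> ()))))"

text \<open>The conjunct \<open>i_dom \<iota>\<close> confines solutions to tuples that represent
  elements; the incompatibility of instances in the interpreted structure says nothing about other
  tuples.\<close>

definition interp_divides_fm :: "('f, 'r, unit, 's) interp \<Rightarrow> ('f, 'r) fm" where
  "interp_divides_fm \<iota> =
     And (i_dom \<iota>) (And (interp_divides \<iota> 1) (Neg (interp_divides \<iota> 2)))"

context
  fixes L :: "('f, 'r) lang" and \<iota> :: "('f, 'r, unit, unit) interp"
    and N :: "('f, 'r, 'm) struct"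
  assumes formulas: "interp_formulas L skolem_lang \<iota>"
begin

abbreviation (input) "idim \<equiv> i_dim \<iota>"

lemma skolem_interp_formulas:
  "0 < idim" "i_dom \<iota> \<in> formulas L idim" "i_fun \<iota> () \<in> formulas L (3 * idim)"
  using formulas by (auto simp: interp_formulas_def skolem_lang_def)

text \<open>The graph formula has its blocks in the order first factor, second factor, value. They
  become block \<open>b\<close>, the cofactor block \<open>3\<close> and block \<open>0\<close>,
  which are distinct for \<open>b\<close> equal to \<open>1\<close> or \<open>2\<close>.\<close>

lemma inj_blocks:
  "b \<in> {1, 2} \<Longrightarrow>
   inj_on (\<lambda>i. if i < idim then b * idim + i else if i < 2 * idim then i + 2 * idim else i - 2 * idim) {..<3 * idim}"
  by (auto simp: inj_on_def)

lemma sat_interp_divides: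
  assumes b: "b \<in> {1, 2}"
  shows "sat N e (interp_divides \<iota> b) \<longleftrightarrow>
    (\<exists>z \<in> interp_dom \<iota> N. holds N (i_fun \<iota> ()) (map e [b * idim..<b * idim + idim] @ z @ map e [0..<idim]))"
proof -
  let ?g = "\<lambda>i. if i < idim then b * idim + i else if i < 2 * idim then i + 2 * idim else i - 2 * idim"
  let ?r = "\<lambda>e i. if i \<in> {3 * idim..<3 * idim + idim} then undefined else e i"
  have r: "map (?r e) [b * idim..<b * idim + idim] = map e [b * idim..<b * idim + idim]"
    "map (?r e) [0..<idim] = map e [0..<idim]" for e :: "nat \<Rightarrow> 'm"
    using b by auto
  have blocks: "map (\<lambda>i. e (?g i)) [0..<3 * idim] =
      map e [b * idim..<b * idim + idim] @ map e [3 * idim..<3 * idim + idim] @ map e [0..<idim]" for e :: "nat \<Rightarrow> 'm"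
    by (rule nth_equalityI) (auto simp: nth_append add.commute mult_2)
  have dom: "map (\<lambda>i. e (3 * idim + i)) [0..<idim] = map e [3 * idim..<3 * idim + idim]" for e :: "nat \<Rightarrow> 'm"
    by (rule nth_equalityI) auto
  have inj: "inj_on (\<lambda>i. 3 * idim + i) {..<idim}" by (simp add: inj_on_def)
  have "sat N e (interp_divides \<iota> b) \<longleftrightarrow> (\<exists>c \<in> tuples N idim. holds N (i_dom \<iota>) c \<and>
      holds N (i_fun \<iota> ()) (map (?r e) [b * idim..<b * idim + idim] @ c @ map (?r e) [0..<idim]))"
    unfolding interp_divides_def Let_def
    by (rule sat_exs_upt)
      (simp only: sat.simps sat_inst[OF inj skolem_interp_formulas(2)]
        sat_inst[OF inj_blocks[OF b] skolem_interp_formulas(3)] blocks dom r)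
  then show ?thesis unfolding r by (auto simp: interp_dom_def)
qed

lemma interp_divides_formula:
  assumes b: "b \<in> {1, 2}"
  shows "interp_divides \<iota> b \<in> formulas L (3 * idim)"
proof -
  have inj: "inj_on (\<lambda>i. 3 * idim + i) {..<idim}" by (simp add: inj_on_def)
  note 1 = inst_formula[OF inj skolem_interp_formulas(2)]
  note 2 = inst_formula[OF inj_blocks[OF b] skolem_interp_formulas(3)]
  have "fv (interp_divides \<iota> b) \<subseteq> {..<3 * idim}"
    using 1(2) 2(2) b unfolding interp_divides_def Let_def fv_exs
    by (auto dest!: subsetD split: if_splits)
  then show ?thesis
    using 1(1) 2(1) by (simp add: formulas_def interp_divides_def Let_def wf_exs)
qed

lemma interp_divides_fm_formula: "interp_divides_fm \<iota> \<in> formulas L (idim + 2 * idim)"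
  using interp_divides_formula[of 1] interp_divides_formula[of 2] skolem_interp_formulas(2)
  by (auto simp: interp_divides_fm_def formulas_def)

lemma holds_interp_divides_fm:
  assumes "x \<in> tuples N idim" "u \<in> tuples N idim" "v \<in> tuples N idim"
  shows "holds N (interp_divides_fm \<iota>) (x @ u @ v) \<longleftrightarrow> x \<in> interp_dom \<iota> N \<and>
    (\<exists>z \<in> interp_dom \<iota> N. holds N (i_fun \<iota> ()) (u @ z @ x)) \<and>
    \<not> (\<exists>z \<in> interp_dom \<iota> N. holds N (i_fun \<iota> ()) (v @ z @ x))"
proof -
  have len: "length x = idim" "length u = idim" "length v = idim"
    using assms by (auto simp: tuples_def)
  define e where "e i = (x @ u @ v) ! i" for i
  have e: "map e [0..<idim] = x" "map e [1 * idim..<1 * idim + idim] = u" "map e [2 * idim..<2 * idim + idim] = v"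
    by (rule nth_equalityI; use len in \<open>auto simp: e_def nth_append\<close>)+
  have "holds N (interp_divides_fm \<iota>) (x @ u @ v) \<longleftrightarrow> sat N e (interp_divides_fm \<iota>)"
    using interp_divides_fm_formula len
    by (intro holds_iff_sat[where L = L]) (auto simp: e_def mult_2)
  also have "\<dots> \<longleftrightarrow> sat N e (i_dom \<iota>) \<and>
    (\<exists>z \<in> interp_dom \<iota> N. holds N (i_fun \<iota> ()) (u @ z @ x)) \<and>
    \<not> (\<exists>z \<in> interp_dom \<iota> N. holds N (i_fun \<iota> ()) (v @ z @ x))"
    using sat_interp_divides[of 1 e] sat_interp_divides[of 2 e] unfolding e
    by (simp add: interp_divides_fm_def)
  also have "sat N e (i_dom \<iota>) \<longleftrightarrow> holds N (i_dom \<iota>) x"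
    using skolem_interp_formulas(2) len
    by (intro holds_iff_sat[where L = L, symmetric]) (auto simp: e_def nth_append)
  finally show ?thesis using assms(1) by (simp add: interp_dom_def)
qed

section \<open>Multiplication on the classes of a well-defined interpretation\<close>

context
  assumes wd: "interp_well_defined skolem_lang \<iota> N"
begin

lemma interp_equiv: "equiv (interp_dom \<iota> N) (interp_eq \<iota> N)"
  using wd by (simp add: interp_well_defined_def Let_def)

lemma interp_graph_total:
  assumes "u \<in> interp_dom \<iota> N" "z \<in> interp_dom \<iota> N"
  shows "\<exists>b \<in> interp_dom \<iota> N. holds N (i_fun \<iota> ()) (u @ z @ b)"
proof -
  have "\<forall>as. length as = 2 \<and> set as \<subseteq> interp_dom \<iota> N \<longrightarrow>
      (\<exists>b \<in> interp_dom \<iota> N. holds N (i_fun \<iota> ()) (concat as @ b))"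
    using wd by (simp add: interp_well_defined_def Let_def skolem_lang_def)
  from this[rule_format, of "[u, z]"] show ?thesis using assms by simp
qed

lemma interp_graph_cong:
  assumes "(u, u') \<in> interp_eq \<iota> N" "(z, z') \<in> interp_eq \<iota> N"
    "b \<in> interp_dom \<iota> N" "b' \<in> interp_dom \<iota> N" "holds N (i_fun \<iota> ()) (u @ z @ b)"
  shows "holds N (i_fun \<iota> ()) (u' @ z' @ b') \<longleftrightarrow> (b, b') \<in> interp_eq \<iota> N"
proof -
  have "\<forall>as as' b b'. length as = 2 \<and>
         list_all2 (\<lambda>x y. (x, y) \<in> interp_eq \<iota> N) as as' \<and> b \<in> interp_dom \<iota> N \<and>
         b' \<in> interp_dom \<iota> N \<and> holds N (i_fun \<iota> ()) (concat as @ b) \<longrightarrow>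
         (holds N (i_fun \<iota> ()) (concat as' @ b') \<longleftrightarrow> (b, b') \<in> interp_eq \<iota> N)"
    using wd by (simp add: interp_well_defined_def Let_def skolem_lang_def) (elim conjE, assumption)
  from this[rule_format, of "[u, z]" "[u', z']" b b'] show ?thesis using assms by simp
qed

text \<open>The graph is total and its value is determined up to \<open>R\<close>, so the definite
  description in \<open>interp_struct\<close> denotes the class of any value \<open>b\<close>. This
  is the class of \<open>x\<close> iff \<open>b\<close> and \<open>x\<close> are equivalent, that
  is, iff \<open>x\<close> is a value too.\<close>

lemma interp_struct_fun:
  assumes u: "u \<in> interp_dom \<iota> N" and z: "z \<in> interp_dom \<iota> N" and x: "x \<in> interp_dom \<iota> N"
  defines "R \<equiv> interp_eq \<iota> N"
  shows "fun_int (interp_struct \<iota> N) () [R `` {u}, R `` {z}] = R `` {x} \<longleftrightarrow>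
    holds N (i_fun \<iota> ()) (u @ z @ x)"
proof -
  let ?D = "interp_dom \<iota> N"
  note eq = interp_equiv[folded R_def]
  have refl: "(a, a) \<in> R" if "a \<in> ?D" for a
    using eq that by (auto simp: equiv_def refl_on_def)
  obtain b where b: "b \<in> ?D" "holds N (i_fun \<iota> ()) (u @ z @ b)"
    using interp_graph_total[OF u z] by blast
  note graph = interp_graph_cong[folded R_def, OF _ _ b(1) _ b(2)]
  have "fun_int (interp_struct \<iota> N) () [R `` {u}, R `` {z}] = R `` {b}"
    unfolding interp_struct_def R_def[symmetric] struct.simps
  proof (rule the_equality)
    show "R `` {b} \<in> ?D // R \<and> (\<exists>as b'. list_all2 (\<in>) as [R `` {u}, R `` {z}] \<and>
        b' \<in> R `` {b} \<and> holds N (i_fun \<iota> ()) (concat as @ b'))"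
      using b refl[OF u] refl[OF z] refl[OF b(1)]
      by (auto intro: quotientI intro!: exI[of _ "[u, z]"] exI[of _ b])
  next
    fix C assume C: "C \<in> ?D // R \<and> (\<exists>as b'. list_all2 (\<in>) as [R `` {u}, R `` {z}] \<and>
        b' \<in> C \<and> holds N (i_fun \<iota> ()) (concat as @ b'))"
    then obtain u' z' b' where *: "(u, u') \<in> R" "(z, z') \<in> R" "b' \<in> C"
      "holds N (i_fun \<iota> ()) (u' @ z' @ b')"
      by (auto simp: list_all2_Cons2)
    have "C \<in> ?D // R" using C by blast
    then obtain c where c: "c \<in> ?D" "C = R `` {c}" by (rule quotientE)
    have "b' \<in> ?D" using *(3) c by (auto simp: R_def interp_eq_def)
    then have "(b, b') \<in> R" using graph[OF *(1,2)] *(4) by simp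
    moreover have "(c, b') \<in> R" using *(3) c(2) by simp
    ultimately show "C = R `` {b}"
      using equiv_class_eq[OF eq] c(2) by metis
  qed
  then show ?thesis
    using graph[OF refl[OF u] refl[OF z] x] eq_equiv_class_iff[OF eq b(1) x] by simp
qed

lemma holds_interp_struct_divides_fm:
  assumes u: "u \<in> interp_dom \<iota> N" and v: "v \<in> interp_dom \<iota> N" and x: "x \<in> interp_dom \<iota> N"
  defines "R \<equiv> interp_eq \<iota> N"
  shows "holds (interp_struct \<iota> N) (divides_fm ()) [R `` {x}, R `` {u}, R `` {v}] \<longleftrightarrow>
    holds N (interp_divides_fm \<iota>) (x @ u @ v)"
proof -
  let ?D = "interp_dom \<iota> N"
  have univ: "univ (interp_struct \<iota> N) = (\<lambda>z. R `` {z}) ` ?D"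
    by (auto simp: interp_struct_def R_def quotient_def)
  have D: "?D \<subseteq> tuples N idim" by (auto simp: interp_dom_def)
  have "(\<exists>Z \<in> univ (interp_struct \<iota> N). fun_int (interp_struct \<iota> N) () [R `` {w}, Z] = R `` {x}) \<longleftrightarrow>
      (\<exists>z \<in> ?D. holds N (i_fun \<iota> ()) (w @ z @ x))" if "w \<in> ?D" for w
    unfolding univ R_def using interp_struct_fun[OF that _ x] by auto
  then show ?thesis
    using u v x D by (subst holds_interp_divides_fm) (auto simp: holds_divides_fm)
qed

text \<open>Parameters and solutions are replaced by representatives. Conversely, a solution among
  the tuples of \<open>N\<close> lies in the domain, so its class solves the same instances in the
  quotient.\<close>

lemma interp_pattern:
  assumes A: "pattern (interp_struct \<iota> N) 1 2 (divides_fm ()) D A"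
  shows "\<exists>a. pattern N idim (2 * idim) (interp_divides_fm \<iota>) D a"
proof -
  let ?D = "interp_dom \<iota> N" and ?I = "interp_struct \<iota> N"
  define R where "R = interp_eq \<iota> N"
  have univ: "univ ?I = (\<lambda>z. R `` {z}) ` ?D"
    by (auto simp: interp_struct_def R_def quotient_def)
  have "\<exists>u v. u \<in> ?D \<and> v \<in> ?D \<and> A \<eta> = [R `` {u}, R `` {v}]" for \<eta>
  proof -
    have "A \<eta> \<in> tuples ?I 2" using A by (simp add: pattern_def)
    then obtain U V where "A \<eta> = [U, V]" "U \<in> univ ?I" "V \<in> univ ?I"
      by (auto simp: tuples_def numeral_2_eq_2 length_Suc_conv)
    then show ?thesis by (auto simp: univ)
  qed
  then obtain u v where uv: "\<And>\<eta>. u \<eta> \<in> ?D" "\<And>\<eta>. v \<eta> \<in> ?D"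
    "\<And>\<eta>. A \<eta> = [R `` {u \<eta>}, R `` {v \<eta>}]" by metis
  have D: "?D \<subseteq> tuples N idim" by (auto simp: interp_dom_def)
  have iff: "holds ?I (divides_fm ()) ([R `` {x}] @ A \<eta>) \<longleftrightarrow>
      holds N (interp_divides_fm \<iota>) (x @ u \<eta> @ v \<eta>)" if "x \<in> ?D" for x \<eta>
    using holds_interp_struct_divides_fm[OF uv(1)[of \<eta>] uv(2)[of \<eta>] that] by (simp add: uv(3) R_def)
  have in_dom: "x \<in> ?D" if "x \<in> tuples N idim" "holds N (interp_divides_fm \<iota>) (x @ u \<eta> @ v \<eta>)" for x \<eta>
    using that holds_interp_divides_fm[OF that(1), of "u \<eta>" "v \<eta>"] uv(1,2) D by blast
  have "pattern N idim (2 * idim) (interp_divides_fm \<iota>) D (\<lambda>\<eta>. u \<eta> @ v \<eta>)"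
    unfolding pattern_def
  proof (intro conjI allI impI ballI)
    show "u \<eta> @ v \<eta> \<in> tuples N (2 * idim)" for \<eta>
      using uv(1,2)[of \<eta>] by (auto simp: interp_dom_def tuples_def)
    show "\<exists>c \<in> tuples N idim. \<forall>\<eta> \<in> X. holds N (interp_divides_fm \<iota>) (c @ u \<eta> @ v \<eta>)"
      if X: "X \<subseteq> D" "finite X \<and> antichain X" for X
    proof -
      obtain c where c: "c \<in> tuples ?I 1" "\<And>\<eta>. \<eta> \<in> X \<Longrightarrow> holds ?I (divides_fm ()) (c @ A \<eta>)"
        by (rule pattern_antichain[OF A]) (use X in auto)
      from c(1) obtain x where x: "x \<in> ?D" "c = [R `` {x}]"
        unfolding tuples_1_iff univ by blast
      have "\<forall>\<eta> \<in> X. holds N (interp_divides_fm \<iota>) (x @ u \<eta> @ v \<eta>)"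
        using c(2) iff[OF x(1)] unfolding x(2) by blast
      then show ?thesis using x(1) D by blast
    qed
    show "\<not> (\<exists>c \<in> tuples N idim. holds N (interp_divides_fm \<iota>) (c @ u \<eta> @ v \<eta>) \<and>
        holds N (interp_divides_fm \<iota>) (c @ u \<nu> @ v \<nu>))"
      if "\<eta> \<in> D" "\<nu> \<in> D" "strict_prefix \<eta> \<nu>" for \<eta> \<nu>
    proof
      assume "\<exists>c \<in> tuples N idim. holds N (interp_divides_fm \<iota>) (c @ u \<eta> @ v \<eta>) \<and>
        holds N (interp_divides_fm \<iota>) (c @ u \<nu> @ v \<nu>)"
      then obtain c where c: "c \<in> tuples N idim" "holds N (interp_divides_fm \<iota>) (c @ u \<eta> @ v \<eta>)"
        "holds N (interp_divides_fm \<iota>) (c @ u \<nu> @ v \<nu>)" by blast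
      have "c \<in> ?D" using in_dom c by blast
      then have "[R `` {c}] \<in> tuples ?I 1" "holds ?I (divides_fm ()) ([R `` {c}] @ A \<eta>)"
        "holds ?I (divides_fm ()) ([R `` {c}] @ A \<nu>)"
        using c iff unfolding tuples_1_iff univ by blast+
      then show False using pattern_prefix[OF A that] by blast
    qed
  qed
  then show ?thesis by blast
qed

end

end

section \<open>From Skolem arithmetic to the theories interpreting it\<close>

text \<open>\<open>interprets\<close> concerns models whose universes consist of formulas, so the
  interpretation is applied to such a model \<open>N\<close> of \<open>T'\<close> and not to the
  monster model. Patterns pass from Skolem arithmetic to the elementarily equivalent
  \<open>interp_struct \<iota> N\<close>, are pulled back to \<open>N\<close>, and from there reach
  \<open>M\<close>.\<close>

lemma has_ATP_if_interprets_skolem: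
  fixes L :: "('f, 'r) lang" and M :: "('f, 'r, 'm) struct"
  assumes int: "interprets L T skolem_lang skolem_arithmetic"
    and T': "completion L T T'" and M: "monster_model L T' M"
  shows "has_ATP L M"
proof -
  obtain N :: "('f, 'r) std_struct" where N: "model_of L T' N"
    using T' by (auto simp: completion_def complete_theory_def)
  then have "model_of L T N"
    using T' by (auto simp: completion_def model_of_def)
  then obtain \<iota> :: "('f, 'r, unit, unit) interp" where \<iota>:
    "interp_formulas L skolem_lang \<iota>" "interp_well_defined skolem_lang \<iota> N"
    "model_of skolem_lang skolem_arithmetic (interp_struct \<iota> N)"
    using int unfolding interprets_def by blast
  show ?thesis
  proof (rule monster_model_has_ATP[OF M, where N = N])
    show "interp_divides_fm \<iota> \<in> formulas L (i_dim \<iota> + 2 * i_dim \<iota>)" "0 < 2 * i_dim \<iota>"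
      using interp_divides_fm_formula[OF \<iota>(1)] skolem_interp_formulas(1)[OF \<iota>(1)] by simp_all
    \<comment> \<open>\<open>T'\<close> is complete and holds in \<open>N\<close>, hence contains
      every sentence true in \<open>N\<close>.\<close>
    show "\<sigma> \<in> T'" if "\<sigma> \<in> sentences L" "holds N \<sigma> []" for \<sigma>
    proof (rule ccontr)
      assume "\<sigma> \<notin> T'"
      then have "Neg \<sigma> \<in> T'" using that(1) T' by (auto simp: completion_def complete_theory_def)
      then have "holds N (Neg \<sigma>) []" using N by (auto simp: model_of_def)
      then show False using that(2) by (simp add: holds_def)
    qed
    show "\<exists>a. pattern N (i_dim \<iota>) (2 * i_dim \<iota>) (interp_divides_fm \<iota>) D a" if D: "finite D" for D
    proof -
      obtain d where d: "D \<subseteq> level d" using finite_subset_level[OF D] .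
      obtain a where "pattern skolem_struct 1 2 (divides_fm ()) (level d) a"
        using skolem_pattern[OF finite_level] by blast
      then have "\<exists>e. satisfied (interp_struct \<iota> N) e (pattern_formulas 1 2 (divides_fm ()) (level d))"
        using \<iota>(3)
        by (intro pattern_transfer[where N = skolem_struct and L = skolem_lang] divides_fm_formula)
          (auto simp: model_of_def structure_of_def skolem_arithmetic_def Th_def skolem_lang_def)
      then obtain A where "pattern (interp_struct \<iota> N) 1 2 (divides_fm ()) (level d) A"
        using satisfied_pattern_formulas[OF divides_fm_formula[of skolem_lang "()"]]
        by (auto simp: satisfied_def skolem_lang_def simp del: One_nat_def)
      then have "pattern (interp_struct \<iota> N) 1 2 (divides_fm ()) D A"
        using d by (rule pattern_mono)
      then show ?thesis by (rule interp_pattern[OF \<iota>(1,2)])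
    qed
  qed
qed

section \<open>Set theory\<close>

text \<open>The counterpart of \<open>divides_fm\<close>: inclusion takes the place of divisibility,
  and single elements play the primes.\<close>

definition subset_fm :: set_fm where
  "subset_fm = And (Forall 3 (Imp (Mem 3 1) (Mem 3 0))) (Neg (Mem 2 0))"

lemma subset_fm_formula: "subset_fm \<in> formulas set_lang (1 + 2)"
  by (auto simp: subset_fm_def formulas_def set_lang_def)

lemma sat_connectives:
  "sat M e (Imp \<phi> \<psi>) \<longleftrightarrow> (sat M e \<phi> \<longrightarrow> sat M e \<psi>)"
  "sat M e (Iff \<phi> \<psi>) \<longleftrightarrow> (sat M e \<phi> \<longleftrightarrow> sat M e \<psi>)"
  "sat M e (Or \<phi> \<psi>) \<longleftrightarrow> (sat M e \<phi> \<or> sat M e \<psi>)"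
  "sat M e (Forall x \<phi>) \<longleftrightarrow> (\<forall>a \<in> univ M. sat M (e(x := a)) \<phi>)"
  by auto

section \<open>Finite sets inside a model of ZFC\<close>

context
  fixes M :: "(unit, unit, 'm) struct"
  assumes zfc: "model_of set_lang ZFC M"
begin

abbreviation mem :: "'m \<Rightarrow> 'm \<Rightarrow> bool" where
  "mem x y \<equiv> rel_int M () [x, y]"

lemma ZFC_holds: "\<sigma> \<in> ZFC \<Longrightarrow> holds M \<sigma> []"
  using zfc by (simp add: model_of_def)

lemma ZFC_pairing:
  assumes "a \<in> univ M" "b \<in> univ M"
  shows "\<exists>c \<in> univ M. \<forall>z \<in> univ M. mem z c \<longleftrightarrow> z = a \<or> z = b"
proof -
  have "holds M pairing []" by (rule ZFC_holds) (simp add: ZFC_def)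
  then have "\<forall>a \<in> univ M. \<forall>b \<in> univ M. \<exists>c \<in> univ M. \<forall>z \<in> univ M. mem z c \<longleftrightarrow> z = a \<or> z = b"
    unfolding holds_def pairing_def sat_connectives sat.simps(1,2,5)
    by (simp add: imp_conv_disj)
  then show ?thesis using assms by blast
qed

lemma ZFC_union:
  assumes "a \<in> univ M"
  shows "\<exists>c \<in> univ M. \<forall>z \<in> univ M. mem z c \<longleftrightarrow> (\<exists>y \<in> univ M. mem y a \<and> mem z y)"
proof -
  have "holds M union []" by (rule ZFC_holds) (simp add: ZFC_def)
  then have "\<forall>a \<in> univ M. \<exists>c \<in> univ M. \<forall>z \<in> univ M.
      mem z c \<longleftrightarrow> (\<exists>y \<in> univ M. mem y a \<and> mem z y)"
    unfolding holds_def union_def sat_connectives sat.simps(1,2,5) by simp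
  then show ?thesis using assms by blast
qed

text \<open>The axiom of infinity asserts in particular that a set without elements exists.\<close>

lemma ZFC_empty: "\<exists>c \<in> univ M. \<forall>z \<in> univ M. \<not> mem z c"
proof -
  have "holds M infinity []" by (rule ZFC_holds) (simp add: ZFC_def)
  then show ?thesis by (simp add: holds_def infinity_def) blast
qed

lemma ZFC_foundation:
  assumes "a \<in> univ M" "b \<in> univ M" "mem b a"
  shows "\<exists>c \<in> univ M. mem c a \<and> \<not> (\<exists>z \<in> univ M. mem z a \<and> mem z c)"
proof -
  have "holds M foundation []" by (rule ZFC_holds) (simp add: ZFC_def)
  then have "\<forall>a \<in> univ M. (\<exists>b \<in> univ M. mem b a) \<longrightarrow>
      (\<exists>c \<in> univ M. mem c a \<and> \<not> (\<exists>z \<in> univ M. mem z a \<and> mem z c))"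
    unfolding holds_def foundation_def sat_connectives sat.simps(1,2,5) by simp
  then show ?thesis using assms by blast
qed

text \<open>Finiteness is meant in the metatheory: finite collections of elements are coded by
  elements, by induction with pairing and union.\<close>

lemma ZFC_finite_set:
  assumes "finite A" "A \<subseteq> univ M"
  shows "\<exists>s \<in> univ M. \<forall>z \<in> univ M. mem z s \<longleftrightarrow> z \<in> A"
  using assms
proof (induction A)
  case empty
  then show ?case using ZFC_empty by simp
next
  case (insert a A)
  then obtain s where s: "s \<in> univ M" "\<forall>z \<in> univ M. mem z s \<longleftrightarrow> z \<in> A" by auto
  have a: "a \<in> univ M" using insert.prems by simp
  \<comment> \<open>\<open>t\<close> is the singleton of \<open>a\<close>, \<open>p\<close> the pair
    of \<open>t\<close> and \<open>s\<close>, and \<open>r\<close> the union of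
    \<open>p\<close>.\<close>
  obtain t where t: "t \<in> univ M" "\<forall>z \<in> univ M. mem z t \<longleftrightarrow> z = a \<or> z = a"
    using ZFC_pairing[OF a a] by blast
  obtain p where p: "p \<in> univ M" "\<forall>z \<in> univ M. mem z p \<longleftrightarrow> z = t \<or> z = s"
    using ZFC_pairing[OF t(1) s(1)] by blast
  obtain r where r: "r \<in> univ M" "\<forall>z \<in> univ M. mem z r \<longleftrightarrow> (\<exists>y \<in> univ M. mem y p \<and> mem z y)"
    using ZFC_union[OF p(1)] by blast
  have "\<forall>z \<in> univ M. mem z r \<longleftrightarrow> z \<in> insert a A"
    using r(2) p(2) t s by auto
  then show ?case using r(1) by blast
qed

text \<open>Otherwise there is a universal set, which is an element of itself.\<close>

lemma ZFC_infinite: "infinite (univ M)"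
proof
  assume "finite (univ M)"
  then obtain V where V: "V \<in> univ M" "\<forall>z \<in> univ M. mem z V"
    using ZFC_finite_set[of "univ M"] by auto
  obtain s where s: "s \<in> univ M" "\<forall>z \<in> univ M. mem z s \<longleftrightarrow> z = V \<or> z = V"
    using ZFC_pairing[OF V(1) V(1)] by blast
  \<comment> \<open>Foundation fails for the singleton \<open>s\<close> of \<open>V\<close>: its
    only element \<open>V\<close> has the element \<open>V\<close> in common with it.\<close>
  show False using ZFC_foundation[OF s(1) V(1)] s V by auto
qed

lemma ZFC_pattern:
  assumes D: "finite D"
  shows "\<exists>a. pattern M 1 2 subset_fm D a"
proof -
  \<comment> \<open>In place of primes, any sequence of distinct elements of the universe can label
    the nodes.\<close>
  obtain f :: "nat \<Rightarrow> 'm" where f: "inj f" "range f \<subseteq> univ M"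
    using infinite_countable_subset[OF ZFC_infinite] by blast
  define q where "q \<eta> = f (to_nat \<eta>)" for \<eta> :: "bool list"
  have q: "q \<eta> \<in> univ M" for \<eta> using f(2) by (auto simp: q_def)
  have q_eq: "q \<eta> = q \<nu> \<longleftrightarrow> \<eta> = \<nu>" for \<eta> \<nu> using f(1) by (simp add: q_def inj_eq)
  define desc where "desc \<eta> = q ` {\<nu> \<in> D. strict_prefix \<eta> \<nu>}" for \<eta>
  have desc: "finite (desc \<eta>)" "desc \<eta> \<subseteq> univ M" for \<eta> using D q by (auto simp: desc_def)
  obtain u where u: "\<And>\<eta>. u \<eta> \<in> univ M" "\<And>\<eta> z. z \<in> univ M \<Longrightarrow> mem z (u \<eta>) \<longleftrightarrow> z \<in> desc \<eta>"
    using ZFC_finite_set[OF desc] by metis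
  have holds: "holds M subset_fm [x, y, z] \<longleftrightarrow>
      (\<forall>w \<in> univ M. mem w y \<longrightarrow> mem w x) \<and> \<not> mem z x" for x y z
    by (simp add: holds_def subset_fm_def)
  have "pattern M 1 2 subset_fm D (\<lambda>\<eta>. [u \<eta>, q \<eta>])"
  proof (rule pattern_1_2I)
    fix X assume X: "X \<subseteq> D" "finite X" "antichain X"
    have "finite (\<Union>\<eta> \<in> X. desc \<eta>)" "(\<Union>\<eta> \<in> X. desc \<eta>) \<subseteq> univ M" using X desc by auto
    then obtain x where x: "x \<in> univ M" "\<forall>z \<in> univ M. mem z x \<longleftrightarrow> z \<in> (\<Union>\<eta> \<in> X. desc \<eta>)"
      by (meson ZFC_finite_set)
    \<comment> \<open>Membership would make \<open>\<nu>\<close> a proper initial segment of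
      \<open>\<eta>\<close>, since \<open>q\<close> is injective.\<close>
    have "q \<eta> \<notin> desc \<nu>" if "\<eta> \<in> X" "\<nu> \<in> X" for \<eta> \<nu>
    proof
      assume "q \<eta> \<in> desc \<nu>"
      then have "strict_prefix \<nu> \<eta>" by (auto simp: desc_def q_eq)
      moreover from this have "\<nu> \<noteq> \<eta>" by auto
      ultimately show False using pairwiseD[OF X(3) that(2,1)] by auto
    qed
    then have "holds M subset_fm [x, u \<eta>, q \<eta>]" if "\<eta> \<in> X" for \<eta>
      using x(2) q u that by (auto simp: holds)
    then show "\<exists>x \<in> univ M. \<forall>\<eta> \<in> X. holds M subset_fm [x, u \<eta>, q \<eta>]" using x(1) by blast
  next
    fix \<eta> \<nu> x assume "\<nu> \<in> D" "strict_prefix \<eta> \<nu>"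
    then have "mem (q \<nu>) (u \<eta>)" using q u(2) by (auto simp: desc_def)
    then show "holds M subset_fm [x, u \<eta>, q \<eta>] \<Longrightarrow> holds M subset_fm [x, u \<nu>, q \<nu>] \<Longrightarrow> False"
      using q by (auto simp: holds)
  qed (use u q in auto)
  then show ?thesis by blast
qed

end

theorem mainTheorem8:
  shows "(\<forall>M :: (unit, unit, 'm) struct.
            monster_model skolem_lang skolem_arithmetic M \<longrightarrow> has_ATP skolem_lang M) \<and>
         (\<forall>(L :: ('f, 'r) lang) T T' (M :: ('f, 'r, 'm) struct).
            interprets L T skolem_lang skolem_arithmetic \<and> completion L T T' \<and> monster_model L T' M
              \<longrightarrow> has_ATP L M) \<and>
         (\<forall>M :: (ring_sym, unit, 'm) struct.
            monster_model ring_lang (Th ring_lang int_ring) M \<longrightarrow> has_ATP ring_lang M) \<and>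
         (\<forall>T (M :: (unit, unit, 'm) struct).
            completion set_lang ZFC T \<and> monster_model set_lang T M \<longrightarrow> has_ATP set_lang M)"
proof (intro conjI allI impI; (elim conjE)?)
  fix M :: "(unit, unit, 'm) struct"
  assume "monster_model skolem_lang skolem_arithmetic M"
  then show "has_ATP skolem_lang M"
    by (rule monster_model_has_ATP[where N = skolem_struct and n = 1 and m = 2 and \<phi> = "divides_fm ()"])
      (use divides_fm_formula[of skolem_lang "()"] skolem_pattern in
        \<open>auto simp: skolem_arithmetic_def Th_def skolem_lang_def\<close>)
next
  fix M :: "(ring_sym, unit, 'm) struct"
  assume "monster_model ring_lang (Th ring_lang int_ring) M"
  then show "has_ATP ring_lang M"
    by (rule monster_model_has_ATP[where N = int_ring and n = 1 and m = 2 and \<phi> = "divides_fm Times"])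
      (use divides_fm_formula[of ring_lang Times] int_ring_pattern in
        \<open>auto simp: Th_def ring_lang_def\<close>)
next
  fix T and M :: "(unit, unit, 'm) struct"
  assume T: "completion set_lang ZFC T" "monster_model set_lang T M"
  then have zfc: "model_of set_lang ZFC M"
    by (auto simp: completion_def monster_model_def model_of_def)
  \<comment> \<open>The patterns exist in every model of ZFC, so the monster model serves as its own
    \<open>N\<close>, whatever the completion \<open>T\<close>.\<close>
  show "has_ATP set_lang M"
  proof (rule has_ATP_if_finite_patterns[where N = M, OF _ _ _ subset_fm_formula])
    show "saturated set_lang M" "univ M \<noteq> {}"
      using T by (auto simp: monster_model_def model_of_def structure_of_def)
    show "\<exists>a. pattern M 1 2 subset_fm (level d) a" for d
      by (rule ZFC_pattern[OF zfc finite_level])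
  qed simp_all
qed (rule has_ATP_if_interprets_skolem)

end
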